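(* Let $p>3$ be a prime and let $G$ be a non-abelian group of order $p^5$. Then, with the groups $G_i$ given by their presentations, \[ \nabla(G)\cong \begin{cases} \mathbb{Z}_{p}^{(3)} & \text{if } G\cong G_i\ (3\le i\le 10),\ G_{11_k},\ G_{12_k},\ G_{28},\ G_{29_a},\ G_{30},\ G_{31},\ G_{32_a},\ G_{33_b},\\ \mathbb{Z}_{p}^{(6)} & \text{if } G\cong G_{34},\ G_{36},\ G_{38},\ G_{39},\ G_{41},\ G_{42},\ G_{44},\ G_{46},\ G_{48_k},\ G_{49},\ G_{50_k},\ G_i\ (54\le i\le 63),\\ \mathbb{Z}_{p}^{(10)} & \text{if } G\cong G_{64},\ G_{65},\ G_{67},\ G_{68},\ G_{69},\\ \mathbb{Z}_{p^2}^{(3)} & \text{if } G\cong G_{2},\ G_{14},\\ \mathbb{Z}_{p^2}\oplus\mathbb{Z}_p^{(5)} & \text{if } G\cong G_{35},\ G_{37},\ G_{40},\ G_{45},\ G_{47},\ G_{52},\ G_{53},\\ \mathbb{Z}_{p^3}\oplus\mathbb{Z}_{p}^{(2)} & \text{if } G\cong G_{15},\ G_{25},\ G_{27}. \end{cases} \]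
   Context: Notation: $\mathbb{Z}_n$ is the cyclic group of order $n$; $A^{(n)}$ is the direct sum of $n$ copies of $A$; $[x,y]=xyx^{-1}y^{-1}$; ${}^{g}g'=gg'g^{-1}$. The non-abelian tensor square $G\otimes G$ is the group generated by symbols $g\otimes h$ ($g,h\in G$) subject to $gg'\otimes h=({}^{g}g'\otimes{}^{g}h)(g\otimes h)$ and $g\otimes hh'=(g\otimes h)({}^{h}g\otimes{}^{h}h')$ for all $g,g',h,h'\in G$. $\nabla(G)$ is the subgroup of $G\otimes G$ generated by all $g\otimes g$, $g\in G$. Groups. Let $w$ be an integer that is a primitive root modulo $p$, let $a,b$ be integers with $a^3\equiv1$ and $b^4\equiv1 \pmod p$, and let $k\in\{1,\dots,\frac{p-1}{2}\}$. Each $G_i$ below has order $p^5$ and is generated by $g_1,\dots,g_5$ subject to the listed relations together with $g_i^p=1$ for every $i$ whose $p$-th power is not listed, and $[g_i,g_j]=1$ for every pair $i>j$ whose commutator is not listed. $G_2$: $[g_2,g_1]=g_3$, $g_1^p=g_4$, $g_2^p=g_5$. $G_3$: $[g_2,g_1]=g_3$, $[g_3,g_1]=g_4$, $[g_3,g_2]=g_5$. $G_4$: the relations of $G_3$ and $g_2^p=g_5$. $G_5$: the relations of $G_3$ and $g_2^p=g_4$. $G_6$: the relations of $G_3$ and $g_2^p=g_4^{w}$. $G_7$: the relations of $G_3$ and $g_1^p=g_4$, $g_2^p=g_5$. $G_8$: $[g_2,g_1]=g_3$, $[g_3,g_1]=g_4g_5$, $[g_3,g_2]=g_5$, $g_1^p=g_4$,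 $g_2^p=g_5$. $G_9$: $[g_2,g_1]=g_3$, $[g_3,g_1]=g_4g_5^{w}$, $[g_3,g_2]=g_5$, $g_1^p=g_4$, $g_2^p=g_5$. $G_{10}$: $[g_2,g_1]=g_3$, $[g_3,g_1]=g_5^{w}$, $[g_3,g_2]=g_4$, $g_1^p=g_4$, $g_2^p=g_5$. $G_{11_k}$: $[g_2,g_1]=g_3$, $[g_3,g_1]=g_4$, $[g_3,g_2]=g_5^{w^k}$, $g_1^p=g_4$, $g_2^p=g_5$. $G_{12_k}$: $[g_2,g_1]=g_3$, $[g_3,g_1]=g_4g_5^{w^k}$, $[g_3,g_2]=g_4^{w^{k-1}}g_5$, $g_1^p=g_4$, $g_2^p=g_5$. $G_{14}$: $[g_2,g_1]=g_5$, $g_1^p=g_3$, $g_2^p=g_4$, $g_3^p=g_5$. $G_{15}$: $[g_2,g_1]=g_3$, $g_1^p=g_4$, $g_4^p=g_5$. $G_{25}$: $[g_2,g_1]=g_3$, $g_1^p=g_4$, $g_2^p=g_3$, $g_4^p=g_5$. $G_{27}$: $g_1^p=g_3$, $g_3^p=g_4$, $g_4^p=g_5$, $[g_2,g_1]=g_5$. $G_{28}$: $[g_2,g_1]=g_3$, $[g_3,g_1]=g_4$, $[g_4,g_1]=g_5$. $G_{29_a}$: $[g_2,g_1]=g_3$, $[g_3,g_1]=g_4$, $[g_4,g_1]=g_5^{w^a}$, $g_2^p=g_5$. $G_{30}$: the relations of $G_{28}$ and $g_1^p=g_5$. $G_{31}$: the relations of $G_{28}$ and $[g_3,g_2]=g_5$.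 $G_{32_a}$: $[g_2,g_1]=g_3$, $[g_3,g_1]=g_4$, $[g_4,g_1]=g_5^{w^a}$, $[g_3,g_2]=g_5^{w^a}$, $g_2^p=g_5$. $G_{33_b}$: $[g_2,g_1]=g_3$, $[g_3,g_1]=g_4$, $[g_4,g_1]=g_5^{w^b}$, $[g_3,g_2]=g_5^{w^b}$, $g_1^p=g_5$. $G_{34}$: $[g_2,g_1]=g_4$, $[g_3,g_1]=g_5$. $G_{35}$: $[g_2,g_1]=g_4$, $g_3^p=g_5$. $G_{36}$: $[g_2,g_1]=g_4$, $[g_3,g_2]=g_5$, $g_3^p=g_5$. $G_{37}$: $[g_3,g_2]=g_4$, $g_3^p=g_5$. $G_{38}$: $[g_3,g_1]=g_4$, $[g_3,g_2]=g_5$, $g_3^p=g_5$. $G_{39}$: $[g_2,g_1]=g_4$, $[g_3,g_2]=g_5$, $g_3^p=g_4$. $G_{40}$: $[g_3,g_2]=g_5$, $g_2^p=g_4$, $g_3^p=g_5$. $G_{41}$: $[g_3,g_1]=g_4$, $[g_3,g_2]=g_5$, $g_2^p=g_4$, $g_3^p=g_5$. $G_{42}$: $[g_2,g_1]=g_4$, $[g_3,g_2]=g_5$, $g_2^p=g_4$, $g_3^p=g_5$. $G_{44}$: $[g_2,g_1]=g_4$, $[g_3,g_1]=g_5$, $g_2^p=g_4$, $g_3^p=g_5$. $G_{45}$: $[g_2,g_1]=g_5$, $g_2^p=g_4$, $g_3^p=g_5$. $G_{46}$: $[g_2,g_1]=g_4g_5$, $[g_3,g_1]=g_5$, $g_2^p=g_4$,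 $g_3^p=g_5$. $G_{47}$: $[g_3,g_1]=g_5$, $g_2^p=g_4$, $g_3^p=g_5$. $G_{48_k}$: $[g_2,g_1]=g_4$, $[g_3,g_1]=g_5^{w^k}$, $g_2^p=g_4$, $g_3^p=g_5$. $G_{49}$ (any admissible $k$): $[g_2,g_1]=g_5^{w^k}$, $[g_3,g_1]=g_4$, $g_2^p=g_4$, $g_3^p=g_5$. $G_{50_k}$: $[g_2,g_1]=g_4g_5^{w^k}$, $[g_3,g_1]=g_4^{w^{k-1}}g_5$, $g_2^p=g_4$, $g_3^p=g_5$. $G_{52}$: $g_1^p=g_4$, $g_4^p=g_5$, $[g_3,g_2]=g_5$. $G_{53}$: $g_1^p=g_4$, $g_4^p=g_5$, $[g_3,g_1]=g_5$. $G_{54}$: $[g_2,g_1]=g_4$, $[g_4,g_2]=g_5$. $G_{55}$: the relations of $G_{54}$ and $g_3^p=g_5$. $G_{56}$: the relations of $G_{54}$ and $g_2^p=g_5$. $G_{57}$: the relations of $G_{54}$ and $g_1^p=g_5$. $G_{58}$: $[g_2,g_1]=g_4$, $[g_4,g_2]=g_5^{w}$, $g_1^p=g_5$. $G_{59}$: $[g_2,g_1]=g_4$, $[g_4,g_2]=g_5$, $[g_3,g_1]=g_5$. $G_{60}$: the relations of $G_{59}$ and $g_3^p=g_5$. $G_{61}$: the relations of $G_{59}$ and $g_2^p=g_5$. $G_{62}$: the relations of $G_{59}$ and $g_1^p=g_5$. $G_{63}$: $[g_2,g_1]=g_4$, $[g_4,g_2]=g_5^{w}$, $[g_3,g_1]=g_5^{w}$,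 $g_1^p=g_5$. $G_{64}$: $[g_2,g_1]=g_5$. $G_{65}$: $[g_2,g_1]=g_5$, $[g_4,g_3]=g_5$. $G_{67}$: $[g_2,g_1]=g_5$, $g_1^p=g_5$. $G_{68}$: $[g_2,g_1]=g_5$, $g_3^p=g_5$. $G_{69}$: $[g_2,g_1]=g_5$, $[g_4,g_3]=g_5$, $g_4^p=g_5$. *)

theory Defs
  imports
    "HOL-Algebra.Product_Groups"
    "HOL-Number_Theory.Residue_Primitive_Roots"
    "HOL-Number_Theory.Modular_Inverse"
begin

text \<open>The letter \<open>(x, True)\<close> stands for the generator \<open>x\<close>, and \<open>(x, False)\<close> for its inverse.\<close>

type_synonym 'x word = "('x \<times> bool) list"

definition words :: "'x set \<Rightarrow> 'x word set" where
  "words X = lists (X \<times> UNIV)"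

definition letter :: "'x \<Rightarrow> 'x word" where
  "letter x = [(x, True)]"

definition word_inv :: "'x word \<Rightarrow> 'x word" where
  "word_inv u = rev (map (\<lambda>(x, e). (x, \<not> e)) u)"

text \<open>The congruence on words generated by free cancellation and by a set \<open>R\<close> of defining
  relations; a pair \<open>(u, v) \<in> R\<close> is the relation \<open>u = v\<close>.\<close>

inductive_set word_cong :: "'x set \<Rightarrow> ('x word \<times> 'x word) set \<Rightarrow> ('x word \<times> 'x word) set"
  for X :: "'x set" and R :: "('x word \<times> 'x word) set" where
  refl: "u \<in> words X \<Longrightarrow> (u, u) \<in> word_cong X R"
| sym: "(u, v) \<in> word_cong X R \<Longrightarrow> (v, u) \<in> word_cong X R"
| trans: "(u, v) \<in> word_cong X R \<Longrightarrow> (v, t) \<in> word_cong X R \<Longrightarrow> (u, t) \<in> word_cong X R"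
| append: "(u, u') \<in> word_cong X R \<Longrightarrow> (v, v') \<in> word_cong X R \<Longrightarrow> (u @ v, u' @ v') \<in> word_cong X R"
| cancel: "x \<in> X \<Longrightarrow> ([(x, e), (x, \<not> e)], []) \<in> word_cong X R"
| rel: "(u, v) \<in> R \<Longrightarrow> u \<in> words X \<Longrightarrow> v \<in> words X \<Longrightarrow> (u, v) \<in> word_cong X R"

definition word_class :: "'x set \<Rightarrow> ('x word \<times> 'x word) set \<Rightarrow> 'x word \<Rightarrow> 'x word set" where
  "word_class X R u = word_cong X R `` {u}"

definition presented_group :: "'x set \<Rightarrow> ('x word \<times> 'x word) set \<Rightarrow> 'x word set monoid" where
  "presented_group X R =
    \<lparr>carrier = words X // word_cong X R,
     monoid.mult = (\<lambda>A B. \<Union>u\<in>A. \<Union>v\<in>B. word_class X R (u @ v)),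
     one = word_class X R []\<rparr>"

definition conjg :: "('a, 'm) monoid_scheme \<Rightarrow> 'a \<Rightarrow> 'a \<Rightarrow> 'a" where
  "conjg G g h = g \<otimes>\<^bsub>G\<^esub> h \<otimes>\<^bsub>G\<^esub> inv\<^bsub>G\<^esub> g"

text \<open>The generator \<open>(g, h)\<close> is the symbol \<open>g \<otimes> h\<close>.\<close>

definition tensor_rels :: "('a, 'm) monoid_scheme \<Rightarrow> (('a \<times> 'a) word \<times> ('a \<times> 'a) word) set" where
  "tensor_rels G =
    {(letter (g \<otimes>\<^bsub>G\<^esub> g', h), letter (conjg G g g', conjg G g h) @ letter (g, h)) |g g' h.
       g \<in> carrier G \<and> g' \<in> carrier G \<and> h \<in> carrier G} \<union>
    {(letter (g, h \<otimes>\<^bsub>G\<^esub> h'), letter (g, h) @ letter (conjg G h g, conjg G h h')) |g h h'.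
       g \<in> carrier G \<and> h \<in> carrier G \<and> h' \<in> carrier G}"

definition tensor_square :: "('a, 'm) monoid_scheme \<Rightarrow> ('a \<times> 'a) word set monoid" where
  "tensor_square G = presented_group (carrier G \<times> carrier G) (tensor_rels G)"

definition tensor :: "('a, 'm) monoid_scheme \<Rightarrow> 'a \<Rightarrow> 'a \<Rightarrow> ('a \<times> 'a) word set" where
  "tensor G g h = word_class (carrier G \<times> carrier G) (tensor_rels G) (letter (g, h))"

definition nabla :: "('a, 'm) monoid_scheme \<Rightarrow> ('a \<times> 'a) word set monoid" where
  "nabla G = subgroup_generated (tensor_square G) {tensor G g g |g. g \<in> carrier G}"

text \<open>The direct sum of \<open>n\<close> copies of the cyclic group of order \<open>m\<close>.\<close>

definition cyc_sum :: "nat \<Rightarrow> nat \<Rightarrow> (nat \<Rightarrow> int) monoid" where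
  "cyc_sum m n = sum_group {..<n} (\<lambda>_. integer_mod_group m)"

text \<open>The word \<open>g\<^sub>i ^ n\<close>; a negative exponent gives letters that are inverses.\<close>

definition gpow :: "nat \<Rightarrow> int \<Rightarrow> nat word" where
  "gpow i n = replicate (nat \<bar>n\<bar>) (i, 0 \<le> n)"

text \<open>The word \<open>[g\<^sub>i, g\<^sub>j] = g\<^sub>i g\<^sub>j g\<^sub>i\<inverse> g\<^sub>j\<inverse>\<close>.\<close>

definition gcomm :: "nat \<Rightarrow> nat \<Rightarrow> nat word" where
  "gcomm i j = letter i @ letter j @ word_inv (letter i) @ word_inv (letter j)"

definition rhs_of :: "('k \<times> nat word) list \<Rightarrow> 'k \<Rightarrow> nat word" where
  "rhs_of L x = (case map_of L x of None \<Rightarrow> [] | Some u \<Rightarrow> u)"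

text \<open>The entry \<open>((i, j), u)\<close> of \<open>C\<close> is the relation \<open>[g\<^sub>i, g\<^sub>j] = u\<close>, and the entry \<open>(i, u)\<close> of
  \<open>P\<close> is the relation \<open>g\<^sub>i ^ p = u\<close>. Commutators \<open>[g\<^sub>i, g\<^sub>j]\<close> with \<open>i > j\<close> and \<open>p\<close>-th powers that
  are not listed are trivial.\<close>

definition pc_group ::
  "nat \<Rightarrow> ((nat \<times> nat) \<times> nat word) list \<Rightarrow> (nat \<times> nat word) list \<Rightarrow> nat word set monoid" where
  "pc_group p C P = presented_group {1..5}
    ({(gcomm i j, rhs_of C (i, j)) |i j. i \<in> {1..5} \<and> j \<in> {1..5} \<and> i > j} \<union>
     {(gpow i (int p), rhs_of P i) |i. i \<in> {1..5}})"

text \<open>The exponent \<open>w ^ a\<close>, which only matters modulo \<open>p\<close>, for a possibly negative integer \<open>a\<close>.\<close>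

definition w_pow :: "nat \<Rightarrow> int \<Rightarrow> int \<Rightarrow> int" where
  "w_pow p w a = (if 0 \<le> a then w ^ nat a else modular_inverse (int p) w ^ nat (- a))"

text \<open>The entry \<open>(i, C, P)\<close> presents the group \<open>G\<^sub>i\<close>. The rows 11, 12, 48, 49, 50 depend
  on \<open>k\<close>, the rows 29, 32 on \<open>a\<close>, and the row 33 on \<open>b\<close>. Numbers that do not occur belong
  to groups that are not needed here, and \<open>G_grp\<close> is unspecified for them.\<close>

definition G_table ::
  "nat \<Rightarrow> int \<Rightarrow> int \<Rightarrow> int \<Rightarrow> nat \<Rightarrow>
    (nat \<times> ((nat \<times> nat) \<times> nat word) list \<times> (nat \<times> nat word) list) list" where
  "G_table p w a b k = [
    (2, [((2, 1), gpow 3 1)],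
      [(1, gpow 4 1), (2, gpow 5 1)]),
    (3, [((2, 1), gpow 3 1), ((3, 1), gpow 4 1), ((3, 2), gpow 5 1)],
      []),
    (4, [((2, 1), gpow 3 1), ((3, 1), gpow 4 1), ((3, 2), gpow 5 1)],
      [(2, gpow 5 1)]),
    (5, [((2, 1), gpow 3 1), ((3, 1), gpow 4 1), ((3, 2), gpow 5 1)],
      [(2, gpow 4 1)]),
    (6, [((2, 1), gpow 3 1), ((3, 1), gpow 4 1), ((3, 2), gpow 5 1)],
      [(2, gpow 4 w)]),
    (7, [((2, 1), gpow 3 1), ((3, 1), gpow 4 1), ((3, 2), gpow 5 1)],
      [(1, gpow 4 1), (2, gpow 5 1)]),
    (8, [((2, 1), gpow 3 1), ((3, 1), gpow 4 1 @ gpow 5 1), ((3, 2), gpow 5 1)],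
      [(1, gpow 4 1), (2, gpow 5 1)]),
    (9, [((2, 1), gpow 3 1), ((3, 1), gpow 4 1 @ gpow 5 w), ((3, 2), gpow 5 1)],
      [(1, gpow 4 1), (2, gpow 5 1)]),
    (10, [((2, 1), gpow 3 1), ((3, 1), gpow 5 w), ((3, 2), gpow 4 1)],
      [(1, gpow 4 1), (2, gpow 5 1)]),
    (11, [((2, 1), gpow 3 1), ((3, 1), gpow 4 1), ((3, 2), gpow 5 (w ^ k))],
      [(1, gpow 4 1), (2, gpow 5 1)]),
    (12, [((2, 1), gpow 3 1), ((3, 1), gpow 4 1 @ gpow 5 (w ^ k)), ((3, 2), gpow 4 (w ^ (k - 1)) @ gpow 5 1)],
      [(1, gpow 4 1), (2, gpow 5 1)]),
    (14, [((2, 1), gpow 5 1)],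
      [(1, gpow 3 1), (2, gpow 4 1), (3, gpow 5 1)]),
    (15, [((2, 1), gpow 3 1)],
      [(1, gpow 4 1), (4, gpow 5 1)]),
    (25, [((2, 1), gpow 3 1)],
      [(1, gpow 4 1), (2, gpow 3 1), (4, gpow 5 1)]),
    (27, [((2, 1), gpow 5 1)],
      [(1, gpow 3 1), (3, gpow 4 1), (4, gpow 5 1)]),
    (28, [((2, 1), gpow 3 1), ((3, 1), gpow 4 1), ((4, 1), gpow 5 1)],
      []),
    (29, [((2, 1), gpow 3 1), ((3, 1), gpow 4 1), ((4, 1), gpow 5 (w_pow p w a))],
      [(2, gpow 5 1)]),
    (30, [((2, 1), gpow 3 1), ((3, 1), gpow 4 1), ((4, 1), gpow 5 1)],
      [(1, gpow 5 1)]),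
    (31, [((2, 1), gpow 3 1), ((3, 1), gpow 4 1), ((4, 1), gpow 5 1), ((3, 2), gpow 5 1)],
      []),
    (32, [((2, 1), gpow 3 1), ((3, 1), gpow 4 1), ((4, 1), gpow 5 (w_pow p w a)), ((3, 2), gpow 5 (w_pow p w a))],
      [(2, gpow 5 1)]),
    (33, [((2, 1), gpow 3 1), ((3, 1), gpow 4 1), ((4, 1), gpow 5 (w_pow p w b)), ((3, 2), gpow 5 (w_pow p w b))],
      [(1, gpow 5 1)]),
    (34, [((2, 1), gpow 4 1), ((3, 1), gpow 5 1)],
      []),
    (35, [((2, 1), gpow 4 1)],
      [(3, gpow 5 1)]),
    (36, [((2, 1), gpow 4 1), ((3, 2), gpow 5 1)],
      [(3, gpow 5 1)]),
    (37, [((3, 2), gpow 4 1)],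
      [(3, gpow 5 1)]),
    (38, [((3, 1), gpow 4 1), ((3, 2), gpow 5 1)],
      [(3, gpow 5 1)]),
    (39, [((2, 1), gpow 4 1), ((3, 2), gpow 5 1)],
      [(3, gpow 4 1)]),
    (40, [((3, 2), gpow 5 1)],
      [(2, gpow 4 1), (3, gpow 5 1)]),
    (41, [((3, 1), gpow 4 1), ((3, 2), gpow 5 1)],
      [(2, gpow 4 1), (3, gpow 5 1)]),
    (42, [((2, 1), gpow 4 1), ((3, 2), gpow 5 1)],
      [(2, gpow 4 1), (3, gpow 5 1)]),
    (44, [((2, 1), gpow 4 1), ((3, 1), gpow 5 1)],
      [(2, gpow 4 1), (3, gpow 5 1)]),
    (45, [((2, 1), gpow 5 1)],
      [(2, gpow 4 1), (3, gpow 5 1)]),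
    (46, [((2, 1), gpow 4 1 @ gpow 5 1), ((3, 1), gpow 5 1)],
      [(2, gpow 4 1), (3, gpow 5 1)]),
    (47, [((3, 1), gpow 5 1)],
      [(2, gpow 4 1), (3, gpow 5 1)]),
    (48, [((2, 1), gpow 4 1), ((3, 1), gpow 5 (w ^ k))],
      [(2, gpow 4 1), (3, gpow 5 1)]),
    (49, [((2, 1), gpow 5 (w ^ k)), ((3, 1), gpow 4 1)],
      [(2, gpow 4 1), (3, gpow 5 1)]),
    (50, [((2, 1), gpow 4 1 @ gpow 5 (w ^ k)), ((3, 1), gpow 4 (w ^ (k - 1)) @ gpow 5 1)],
      [(2, gpow 4 1), (3, gpow 5 1)]),
    (52, [((3, 2), gpow 5 1)],
      [(1, gpow 4 1), (4, gpow 5 1)]),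
    (53, [((3, 1), gpow 5 1)],
      [(1, gpow 4 1), (4, gpow 5 1)]),
    (54, [((2, 1), gpow 4 1), ((4, 2), gpow 5 1)],
      []),
    (55, [((2, 1), gpow 4 1), ((4, 2), gpow 5 1)],
      [(3, gpow 5 1)]),
    (56, [((2, 1), gpow 4 1), ((4, 2), gpow 5 1)],
      [(2, gpow 5 1)]),
    (57, [((2, 1), gpow 4 1), ((4, 2), gpow 5 1)],
      [(1, gpow 5 1)]),
    (58, [((2, 1), gpow 4 1), ((4, 2), gpow 5 w)],
      [(1, gpow 5 1)]),
    (59, [((2, 1), gpow 4 1), ((4, 2), gpow 5 1), ((3, 1), gpow 5 1)],
      []),
    (60, [((2, 1), gpow 4 1), ((4, 2), gpow 5 1), ((3, 1), gpow 5 1)],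
      [(3, gpow 5 1)]),
    (61, [((2, 1), gpow 4 1), ((4, 2), gpow 5 1), ((3, 1), gpow 5 1)],
      [(2, gpow 5 1)]),
    (62, [((2, 1), gpow 4 1), ((4, 2), gpow 5 1), ((3, 1), gpow 5 1)],
      [(1, gpow 5 1)]),
    (63, [((2, 1), gpow 4 1), ((4, 2), gpow 5 w), ((3, 1), gpow 5 w)],
      [(1, gpow 5 1)]),
    (64, [((2, 1), gpow 5 1)],
      []),
    (65, [((2, 1), gpow 5 1), ((4, 3), gpow 5 1)],
      []),
    (67, [((2, 1), gpow 5 1)],
      [(1, gpow 5 1)]),
    (68, [((2, 1), gpow 5 1)],
      [(3, gpow 5 1)]),
    (69, [((2, 1), gpow 5 1), ((4, 3), gpow 5 1)],
      [(4, gpow 5 1)])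
  ]"

definition G_grp :: "nat \<Rightarrow> int \<Rightarrow> int \<Rightarrow> int \<Rightarrow> nat \<Rightarrow> nat \<Rightarrow> nat word set monoid" where
  "G_grp p w a b k i = (case the (map_of (G_table p w a b k) i) of (C, P) \<Rightarrow> pc_group p C P)"

end

theory Submission
  imports Defs
begin

text \<open>In the tensor square the diagonal elements \<open>q(g) = g \<otimes> g\<close> are central and depend only on the
  conjugacy class of \<open>g\<close>, and \<open>b(g, h) = (g \<otimes> h)(h \<otimes> g)\<close> is a symmetric bimultiplicative form with
  \<open>q(gh) = b(g, h) q(g) q(h)\<close>; so \<open>b\<close> factors through the abelianisation \<open>A\<close> of the group. If the
  order of the group is odd, \<open>q(g)\<close> is a power of \<open>q(g)\<^sup>2 = b(g, g)\<close>. Hence, if \<open>A\<close> is the direct sum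
  of cyclic groups with generators \<open>x\<^sub>i\<close> of order \<open>n\<^sub>i\<close>, \<open>\<nabla>\<close> is generated by the
  \<open>b(x\<^sub>i, x\<^sub>j)\<close> with \<open>i \<le> j\<close>, whose orders divide \<open>gcd(n\<^sub>i, n\<^sub>j)\<close>. The bilinear maps
  \<open>g \<otimes> h \<mapsto> \<chi>\<^sub>i(g) \<chi>\<^sub>j(h)\<close> modulo \<open>gcd(n\<^sub>i, n\<^sub>j)\<close>, with \<open>\<chi>\<^sub>i\<close> dual to \<open>x\<^sub>i\<close>, separate these
  generators (the diagonal ones take the value \<open>2\<close>, a unit), so \<open>\<nabla>\<close> is the direct sum of the cyclic groups
  of order \<open>gcd(n\<^sub>i, n\<^sub>j)\<close>. It remains to read off \<open>A\<close> from the presentations. In the rows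
  12 and 50 the abelianised relations between \<open>g\<^sub>4\<close> and \<open>g\<^sub>5\<close> have determinant
  \<open>1 - w\<^bsup>2k-1\<^esup>\<close>, a unit modulo \<open>p\<close> because \<open>2k - 1\<close> is odd and \<open>w\<close> is a primitive root.\<close>

subsection \<open>Presented groups\<close>

lemma words_simps [simp]:
  "[] \<in> words X"
  "u @ v \<in> words X \<longleftrightarrow> u \<in> words X \<and> v \<in> words X"
  "l # u \<in> words X \<longleftrightarrow> fst l \<in> X \<and> u \<in> words X"
  "letter x \<in> words X \<longleftrightarrow> x \<in> X"
  "word_inv u \<in> words X \<longleftrightarrow> u \<in> words X"
  by (cases l; force simp: words_def letter_def word_inv_def in_lists_conv_set)+

lemma word_cong_words:
  assumes "(u, v) \<in> word_cong X R"
  shows "u \<in> words X" "v \<in> words X"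
  using assms by (induction) auto

lemma equiv_word_cong: "equiv (words X) (word_cong X R)"
proof (rule equivI)
  show "word_cong X R \<subseteq> words X \<times> words X"
    using word_cong_words by fast
  show "refl_on (words X) (word_cong X R)"
    by (simp add: refl_on_def word_cong.refl)
  show "sym (word_cong X R)" "trans (word_cong X R)"
    by (auto simp: sym_def trans_def intro: word_cong.sym word_cong.trans)
qed

lemma word_class_eq_iff:
  assumes "u \<in> words X" "v \<in> words X"
  shows "word_class X R u = word_class X R v \<longleftrightarrow> (u, v) \<in> word_cong X R"
  unfolding word_class_def using eq_equiv_class_iff[OF equiv_word_cong] assms by blast

lemma mem_word_class: "v \<in> word_class X R u \<longleftrightarrow> (u, v) \<in> word_cong X R"
  by (simp add: word_class_def)

lemma carrier_presented_group: "carrier (presented_group X R) = word_class X R ` words X"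
  by (auto simp: presented_group_def quotient_def word_class_def)

lemma word_class_closed [simp]:
  "u \<in> words X \<Longrightarrow> word_class X R u \<in> carrier (presented_group X R)"
  by (simp add: carrier_presented_group)

lemma one_presented_group: "\<one>\<^bsub>presented_group X R\<^esub> = word_class X R []"
  by (simp add: presented_group_def)

text \<open>The product of classes is a union over all representatives. As the congruence respects
  concatenation, every class in that union is the same one, and the union is inhabited by the pair
  \<open>u\<close>, \<open>v\<close>.\<close>

lemma mult_presented_group:
  assumes "u \<in> words X" "v \<in> words X"
  shows "word_class X R u \<otimes>\<^bsub>presented_group X R\<^esub> word_class X R v = word_class X R (u @ v)"
proof -
  have "word_class X R (u' @ v') = word_class X R (u @ v)"
    if "u' \<in> word_class X R u" "v' \<in> word_class X R v" for u' v'
    using that word_cong.append[of u u' X R v v'] word_cong_words[of _ _ X R]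
    by (auto simp: mem_word_class word_class_eq_iff intro: word_cong.sym)
  moreover have "u \<in> word_class X R u" "v \<in> word_class X R v"
    using assms by (simp_all add: mem_word_class word_cong.refl)
  ultimately show ?thesis
    unfolding presented_group_def monoid.simps
    by (intro equalityI UN_least) (metis order.refl, blast)
qed

lemma word_inv_cancel:
  assumes "u \<in> words X"
  shows "(word_inv u @ u, []) \<in> word_cong X R"
  using assms
proof (induction u)
  case Nil
  then show ?case by (simp add: word_inv_def word_cong.refl)
next
  case (Cons l u)
  obtain x e where l: "l = (x, e)" by (cases l)
  have "([(x, \<not> e), (x, e)], []) \<in> word_cong X R"
    using word_cong.cancel[of x X "\<not> e" R] Cons.prems l by simp
  \<comment> \<open>Inversion reverses a word, so the first letter and its inverse meet in the
    middle; once this pair is cancelled, the induction hypothesis applies to what remains. A left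
    inverse is all that \<open>groupI\<close> asks for.\<close>
  then have "(word_inv u @ [(x, \<not> e), (x, e)] @ u, word_inv u @ [] @ u) \<in> word_cong X R"
    using Cons.prems by (intro word_cong.append) (auto intro: word_cong.refl)
  then show ?case
    using Cons l by (auto simp: word_inv_def intro: word_cong.trans)
qed

lemma group_presented_group [simp]: "group (presented_group X R)"
proof -
  have "\<exists>B\<in>carrier (presented_group X R). B \<otimes>\<^bsub>presented_group X R\<^esub> word_class X R u = \<one>\<^bsub>presented_group X R\<^esub>"
    if "u \<in> words X" for u
    using that word_inv_cancel[of u X R]
    by (intro bexI[of _ "word_class X R (word_inv u)"])
      (simp_all add: one_presented_group mult_presented_group word_class_eq_iff)
  then show ?thesis
    by (intro groupI; unfold carrier_presented_group)
      (auto simp: mult_presented_group one_presented_group)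
qed

text \<open>This is the homomorphism from the free monoid on signed letters that sends a letter to
  its value under \<open>f\<close> or to the inverse of that value. On classes it becomes the
  homomorphism out of a presented group.\<close>

primrec weval :: "('b, 'm) monoid_scheme \<Rightarrow> ('x \<Rightarrow> 'b) \<Rightarrow> 'x word \<Rightarrow> 'b" where
  "weval H f [] = \<one>\<^bsub>H\<^esub>"
| "weval H f (l # u) =
    (if snd l then f (fst l) else inv\<^bsub>H\<^esub> f (fst l)) \<otimes>\<^bsub>H\<^esub> weval H f u"

context group
begin

lemma weval_closed [simp]:
  assumes "f \<in> X \<rightarrow> carrier G" "u \<in> words X"
  shows "weval G f u \<in> carrier G"
  using assms by (induction u) auto

lemma weval_append:
  assumes "f \<in> X \<rightarrow> carrier G" "u \<in> words X" "v \<in> words X"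
  shows "weval G f (u @ v) = weval G f u \<otimes> weval G f v"
  using assms(2)
proof (induction u)
  case (Cons l u)
  then have "f (fst l) \<in> carrier G" using assms by auto
  with Cons assms show ?case by (simp add: m_assoc)
qed (use assms in simp)

lemma weval_word_cong:
  assumes f: "f \<in> X \<rightarrow> carrier G"
    and R: "\<And>u v. (u, v) \<in> R \<Longrightarrow> u \<in> words X \<Longrightarrow> v \<in> words X \<Longrightarrow> weval G f u = weval G f v"
    and "(u, v) \<in> word_cong X R"
  shows "weval G f u = weval G f v"
  using assms(3)
proof (induction)
  case (append u u' v v')
  then show ?case using weval_append[OF f] word_cong_words by metis
next
  case (cancel x e)
  then have "f x \<in> carrier G" using f by auto
  then show ?case by simp
qed (use R in auto)

lemma weval_in_generate:
  assumes "u \<in> words X"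
  shows "weval G f u \<in> generate G (f ` X)"
  using assms by (induction u) (auto intro: generate.intros)

end

lemma weval_hom:
  assumes "group H" "group K" "\<phi> \<in> hom H K" "f \<in> X \<rightarrow> carrier H" "u \<in> words X"
  shows "\<phi> (weval H f u) = weval K (\<phi> \<circ> f) u"
proof -
  interpret group_hom H K \<phi>
    using assms by (simp add: group_hom_def group_hom_axioms_def)
  show ?thesis
    using assms(5)
  proof (induction u)
    case (Cons l u)
    then have "f (fst l) \<in> carrier H" using assms by auto
    with Cons assms show ?case by (simp add: group.weval_closed[of H f X])
  qed simp
qed

text \<open>Every class is the value of its own word at the classes of the letters. Hence the
  letters generate the presented group, and through \<open>weval_hom\<close> a homomorphism out of
  it is determined by its values on them.\<close>

lemma weval_presented_group:
  assumes "u \<in> words X"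
  shows "weval (presented_group X R) (\<lambda>x. word_class X R (letter x)) u = word_class X R u"
  using assms
proof (induction u)
  case Nil
  then show ?case by (simp add: one_presented_group)
next
  case (Cons l u)
  obtain x e where l: "l = (x, e)" by (cases l)
  with Cons have x: "x \<in> X" by simp
  have "inv\<^bsub>presented_group X R\<^esub> (word_class X R (letter x)) = word_class X R [(x, False)]"
    using x word_cong.cancel[of x X False R]
    by (intro group.inv_equality)
      (auto simp: mult_presented_group one_presented_group word_class_eq_iff letter_def)
  then show ?case
    using Cons l x by (auto simp: mult_presented_group letter_def)
qed

text \<open>Von Dyck's theorem. A representative is picked with \<open>SOME\<close>; by
  \<open>weval_word_cong\<close> its evaluation does not depend on the choice, and
  \<open>weval_append\<close> makes the map multiplicative.\<close>

lemma presented_group_hom: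
  assumes "group H" "f \<in> X \<rightarrow> carrier H"
    and "\<And>u v. (u, v) \<in> R \<Longrightarrow> u \<in> words X \<Longrightarrow> v \<in> words X \<Longrightarrow> weval H f u = weval H f v"
  obtains \<phi> where "\<phi> \<in> hom (presented_group X R) H"
    and "\<And>u. u \<in> words X \<Longrightarrow> \<phi> (word_class X R u) = weval H f u"
proof
  let ?\<phi> = "\<lambda>A. weval H f (SOME u. u \<in> words X \<and> A = word_class X R u)"
  interpret group H by fact
  show *: "?\<phi> (word_class X R u) = weval H f u" if "u \<in> words X" for u
  proof -
    have "\<exists>v. v \<in> words X \<and> word_class X R u = word_class X R v" using that by blast
    from someI_ex[OF this] that show ?thesis
      by (metis (mono_tags, lifting) weval_word_cong[OF assms(2,3)] word_class_eq_iff)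
  qed
  show "?\<phi> \<in> hom (presented_group X R) H"
  proof (rule homI)
    fix A B
    assume "A \<in> carrier (presented_group X R)" "B \<in> carrier (presented_group X R)"
    then obtain u v where
      "u \<in> words X" "A = word_class X R u" "v \<in> words X" "B = word_class X R v"
      by (auto simp: carrier_presented_group)
    then show "?\<phi> (A \<otimes>\<^bsub>presented_group X R\<^esub> B) = ?\<phi> A \<otimes>\<^bsub>H\<^esub> ?\<phi> B"
      using * by (simp add: mult_presented_group weval_append[OF assms(2)])
  next
    fix A assume "A \<in> carrier (presented_group X R)"
    then obtain u where "u \<in> words X" "A = word_class X R u"
      by (auto simp: carrier_presented_group)
    then show "?\<phi> A \<in> carrier H"
      using * weval_closed[OF assms(2)] by simp
  qed
qed

subsection \<open>The diagonal of the tensor square\<close>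

lemma (in group) commute_inv:
  assumes "a \<in> carrier G" "b \<in> carrier G" "a \<otimes> b = b \<otimes> a"
  shows "inv a \<otimes> b = b \<otimes> inv a"
proof -
  have "inv a \<otimes> b = inv a \<otimes> (b \<otimes> a) \<otimes> inv a" using assms(1,2) by (simp add: m_assoc)
  also have "b \<otimes> a = a \<otimes> b" using assms(3) by simp
  also have "inv a \<otimes> (a \<otimes> b) = b" using assms(1,2) by (simp flip: m_assoc)
  finally show ?thesis .
qed

context group
begin

lemma conjg_closed [simp]:
  "g \<in> carrier G \<Longrightarrow> h \<in> carrier G \<Longrightarrow> conjg G g h \<in> carrier G"
  by (simp add: conjg_def)

lemma conjg_self [simp]: "g \<in> carrier G \<Longrightarrow> conjg G g g = g"
  by (simp add: conjg_def m_assoc)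

lemma conjg_one [simp]: "g \<in> carrier G \<Longrightarrow> conjg G g \<one> = \<one>"
  by (simp add: conjg_def)

lemma one_conjg [simp]: "g \<in> carrier G \<Longrightarrow> conjg G \<one> g = g"
  by (simp add: conjg_def)

lemma conjg_mult:
  assumes "x \<in> carrier G" "g \<in> carrier G" "h \<in> carrier G"
  shows "conjg G x (g \<otimes> h) = conjg G x g \<otimes> conjg G x h"
  using assms by (simp add: conjg_def m_assoc inv_solve_left)

lemma conjg_conjg:
  assumes "x \<in> carrier G" "g \<in> carrier G" "h \<in> carrier G"
  shows "conjg G x (conjg G g h) = conjg G (x \<otimes> g) h"
  using assms by (simp add: conjg_def m_assoc inv_mult_group)

lemma conjg_inv:
  assumes "x \<in> carrier G" "g \<in> carrier G"
  shows "conjg G x (inv g) = inv (conjg G x g)"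
  using assms by (simp add: conjg_def m_assoc inv_mult_group)

lemma group_tensor_square [simp]: "group (tensor_square G)"
  by (simp add: tensor_square_def)

lemma tensor_closed [simp]:
  "g \<in> carrier G \<Longrightarrow> h \<in> carrier G \<Longrightarrow> tensor G g h \<in> carrier (tensor_square G)"
  by (simp add: tensor_def tensor_square_def)

lemma tensor_mult_left:
  assumes "g \<in> carrier G" "g' \<in> carrier G" "h \<in> carrier G"
  shows "tensor G (g \<otimes> g') h =
    tensor G (conjg G g g') (conjg G g h) \<otimes>\<^bsub>tensor_square G\<^esub> tensor G g h"
proof -
  have "(letter (g \<otimes> g', h), letter (conjg G g g', conjg G g h) @ letter (g, h)) \<in> tensor_rels G"
    unfolding tensor_rels_def using assms by blast
  then show ?thesis
    using assms
    by (simp add: tensor_def tensor_square_def mult_presented_group word_class_eq_iff word_cong.rel)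
qed

lemma tensor_mult_right:
  assumes "g \<in> carrier G" "h \<in> carrier G" "h' \<in> carrier G"
  shows "tensor G g (h \<otimes> h') =
    tensor G g h \<otimes>\<^bsub>tensor_square G\<^esub> tensor G (conjg G h g) (conjg G h h')"
proof -
  have "(letter (g, h \<otimes> h'), letter (g, h) @ letter (conjg G h g, conjg G h h')) \<in> tensor_rels G"
    unfolding tensor_rels_def using assms by blast
  then show ?thesis
    using assms
    by (simp add: tensor_def tensor_square_def mult_presented_group word_class_eq_iff word_cong.rel)
qed

lemma tensor_one_left [simp]:
  assumes "h \<in> carrier G"
  shows "tensor G \<one> h = \<one>\<^bsub>tensor_square G\<^esub>"
proof -
  interpret T: group "tensor_square G" by simp
  show ?thesis
    using tensor_mult_left[of \<one> \<one> h] assms T.l_cancel_one' tensor_closed[of \<one> h] by auto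
qed

lemma tensor_one_right [simp]:
  assumes "h \<in> carrier G"
  shows "tensor G h \<one> = \<one>\<^bsub>tensor_square G\<^esub>"
proof -
  interpret T: group "tensor_square G" by simp
  show ?thesis
    using tensor_mult_right[of h \<one> \<one>] assms T.l_cancel_one' tensor_closed[of h \<one>] by auto
qed

text \<open>The symbols generate, since every class is the evaluation of its word at the symbols.
  This serves as an induction principle: a property that defines a subgroup need only be checked on
  symbols.\<close>

lemma tensor_square_subgroup_eq:
  assumes "subgroup H (tensor_square G)"
    and "\<And>g h. g \<in> carrier G \<Longrightarrow> h \<in> carrier G \<Longrightarrow> tensor G g h \<in> H"
  shows "H = carrier (tensor_square G)"
proof
  interpret T: group "tensor_square G" by simp
  let ?X = "carrier G \<times> carrier G"
  let ?f = "\<lambda>x. word_class ?X (tensor_rels G) (letter x)"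
  show "H \<subseteq> carrier (tensor_square G)"
    using assms(1) by (rule subgroup.subset)
  have "generate (tensor_square G) (?f ` ?X) \<subseteq> H"
    using assms by (intro T.generate_subgroup_incl) (auto simp: tensor_def)
  then show "carrier (tensor_square G) \<subseteq> H"
    using T.weval_in_generate[of _ ?X ?f] weval_presented_group[of _ ?X "tensor_rels G"]
    by (fastforce simp: tensor_square_def carrier_presented_group)
qed

text \<open>Expand \<open>x g' \<otimes> x h'\<close> in the two possible orders, where \<open>g\<close> and \<open>h\<close> are the conjugates of
  \<open>g'\<close> and \<open>h'\<close> by \<open>x\<^sup>2\<close>.\<close>

lemma tensor_diag_commute_tensor:
  assumes x: "x \<in> carrier G" and g: "g \<in> carrier G" and h: "h \<in> carrier G"
  shows "tensor G x x \<otimes>\<^bsub>tensor_square G\<^esub> tensor G g h =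
    tensor G g h \<otimes>\<^bsub>tensor_square G\<^esub> tensor G x x"
proof -
  interpret T: group "tensor_square G" by simp
  define g' where "g' = conjg G (inv (x \<otimes> x)) g"
  define h' where "h' = conjg G (inv (x \<otimes> x)) h"
  have c: "g' \<in> carrier G" "h' \<in> carrier G" "g = conjg G (x \<otimes> x) g'" "h = conjg G (x \<otimes> x) h'"
    using x g h by (simp_all add: g'_def h'_def conjg_conjg)
  let ?A = "tensor G (conjg G x g') x" and ?C = "tensor G x (conjg G x h')"
  \<comment> \<open>Here the left argument is split first, below the right one. Both results begin
    with \<open>?A\<close> and end with \<open>?C\<close> and differ only in the order of the two
    middle factors.\<close>
  have "tensor G (x \<otimes> g') (x \<otimes> h') =
      (?A \<otimes>\<^bsub>tensor_square G\<^esub> tensor G g h) \<otimes>\<^bsub>tensor_square G\<^esub> (tensor G x x \<otimes>\<^bsub>tensor_square G\<^esub> ?C)"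
    using x c by (subst tensor_mult_left) (simp_all add: tensor_mult_right conjg_mult conjg_conjg T.m_assoc)
  moreover have "tensor G (x \<otimes> g') (x \<otimes> h') =
      (?A \<otimes>\<^bsub>tensor_square G\<^esub> tensor G x x) \<otimes>\<^bsub>tensor_square G\<^esub> (tensor G g h \<otimes>\<^bsub>tensor_square G\<^esub> ?C)"
    using x c by (subst tensor_mult_right) (simp_all add: tensor_mult_left conjg_mult conjg_conjg T.m_assoc)
  ultimately show ?thesis
    using x g h c by (simp add: T.m_assoc) (simp flip: T.m_assoc)
qed

text \<open>The centraliser of \<open>tensor G x x\<close> is a subgroup, and by the preceding lemma
  it contains all symbols.\<close>

lemma tensor_diag_commute:
  assumes x: "x \<in> carrier G" and t: "t \<in> carrier (tensor_square G)"
  shows "tensor G x x \<otimes>\<^bsub>tensor_square G\<^esub> t = t \<otimes>\<^bsub>tensor_square G\<^esub> tensor G x x"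
proof -
  interpret T: group "tensor_square G" by simp
  let ?H = "{t \<in> carrier (tensor_square G).
    tensor G x x \<otimes>\<^bsub>tensor_square G\<^esub> t = t \<otimes>\<^bsub>tensor_square G\<^esub> tensor G x x}"
  have "subgroup ?H (tensor_square G)"
  proof (rule T.subgroupI)
    show "?H \<noteq> {}" using x by (auto intro!: exI[of _ "\<one>\<^bsub>tensor_square G\<^esub>"])
    show "inv\<^bsub>tensor_square G\<^esub> t \<in> ?H" if "t \<in> ?H" for t
      using that x T.commute_inv[of t "tensor G x x"] by auto
    show "s \<otimes>\<^bsub>tensor_square G\<^esub> t \<in> ?H" if "s \<in> ?H" "t \<in> ?H" for s t
      using that x by simp (metis T.m_assoc tensor_closed)
  qed auto
  then have "?H = carrier (tensor_square G)"
    using x by (intro tensor_square_subgroup_eq) (auto simp: tensor_diag_commute_tensor)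
  then show ?thesis using t by blast
qed

text \<open>Expand the trivial symbols in which one argument is \<open>x\<close> and the other is
  \<open>x \<otimes> inv x\<close>; conjugation by \<open>x\<close> fixes \<open>x\<close> and
  \<open>inv x\<close>. In the first case the diagonal factor comes out on the left, and centrality
  moves it to the right.\<close>

lemma tensor_inv_self:
  assumes x: "x \<in> carrier G"
  shows "tensor G x (inv x) = inv\<^bsub>tensor_square G\<^esub> tensor G x x"
    and "tensor G (inv x) x = inv\<^bsub>tensor_square G\<^esub> tensor G x x"
proof -
  interpret T: group "tensor_square G" by simp
  show "tensor G x (inv x) = inv\<^bsub>tensor_square G\<^esub> tensor G x x"
    using tensor_mult_right[of x x "inv x"] x
    by (intro T.inv_equality[symmetric]) (auto simp: conjg_inv tensor_diag_commute)
  show "tensor G (inv x) x = inv\<^bsub>tensor_square G\<^esub> tensor G x x"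
    using tensor_mult_left[of x "inv x" x] x
    by (intro T.inv_equality[symmetric]) (auto simp: conjg_inv)
qed

text \<open>Expand \<open>x \<otimes> x h x\<inverse>\<close> with \<open>h = x\<inverse> g\<close>: the factor \<open>x \<otimes> x\<inverse>\<close> reappears conjugated by
  \<open>g\<close>, and the rest cancels because \<open>x \<otimes> x\<close> is central.\<close>

lemma tensor_diag_conjg:
  assumes x: "x \<in> carrier G" and g: "g \<in> carrier G"
  shows "tensor G (conjg G g x) (conjg G g x) = tensor G x x"
proof -
  interpret T: group "tensor_square G" by simp
  let ?q = "tensor G x x" and ?y = "conjg G g x" and ?h = "inv x \<otimes> g"
  have h: "?h \<in> carrier G" "x \<otimes> ?h = g" using x g by (simp_all flip: m_assoc)
  have "conjg G x ?h = x \<otimes> (?h \<otimes> inv x)" using x g by (simp add: conjg_def m_assoc)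
  then have "tensor G x (conjg G x ?h) = ?q \<otimes>\<^bsub>tensor_square G\<^esub>
      tensor G x (conjg G x (?h \<otimes> inv x))"
    using x h by (simp add: tensor_mult_right)
  also have "conjg G x (?h \<otimes> inv x) = conjg G x ?h \<otimes> inv x"
    using x h by (simp add: conjg_mult conjg_inv)
  also have "tensor G x (conjg G x ?h \<otimes> inv x) = tensor G x (conjg G x ?h) \<otimes>\<^bsub>tensor_square G\<^esub>
      tensor G ?y (inv ?y)"
  proof -
    \<comment> \<open>As \<open>x\<close> fixes itself, conjugating it by
      \<open>conjg G x ?h\<close> has the same effect as conjugating it by
      \<open>conjg G x ?h \<otimes> x = x \<otimes> ?h = g\<close>. This is what the choice of
      \<open>?h\<close> was made for.\<close>
    have "conjg G (conjg G x ?h) x = conjg G (conjg G x ?h) (conjg G x x)" using x by simp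
    also have "\<dots> = conjg G (conjg G x ?h \<otimes> x) x" using x h by (intro conjg_conjg) auto
    also have "conjg G x ?h \<otimes> x = g" using x g h by (simp add: conjg_def) (simp add: m_assoc)
    finally have "conjg G (conjg G x ?h) x = ?y" .
    then show ?thesis
      using x h by (simp add: tensor_mult_right conjg_inv)
  qed
  finally have "tensor G x (conjg G x ?h) =
    ?q \<otimes>\<^bsub>tensor_square G\<^esub> (tensor G x (conjg G x ?h) \<otimes>\<^bsub>tensor_square G\<^esub> inv\<^bsub>tensor_square G\<^esub> tensor G ?y ?y)"
    using x g by (simp add: tensor_inv_self)
  also have "\<dots> = tensor G x (conjg G x ?h) \<otimes>\<^bsub>tensor_square G\<^esub> (?q \<otimes>\<^bsub>tensor_square G\<^esub> inv\<^bsub>tensor_square G\<^esub> tensor G ?y ?y)"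
    using x g h by (simp add: tensor_diag_commute[of x "tensor G x (conjg G x ?h)"] flip: T.m_assoc)
  \<comment> \<open>The same factor \<open>tensor G x (conjg G x ?h)\<close> stands on both sides,
    so it cancels.\<close>
  finally have "?q \<otimes>\<^bsub>tensor_square G\<^esub> inv\<^bsub>tensor_square G\<^esub> tensor G ?y ?y = \<one>\<^bsub>tensor_square G\<^esub>"
    using x g h by (subst (asm) T.l_cancel_one') auto
  then show ?thesis
    using x g by (subst (asm) T.inv_solve_right') auto
qed

end

subsection \<open>Direct sums of cyclic groups\<close>

lemma carrier_sum_group_finite:
  assumes "finite I" "\<And>i. i \<in> I \<Longrightarrow> group (F i)"
  shows "carrier (sum_group I F) = (\<Pi>\<^sub>E i\<in>I. carrier (F i))"
  using assms by (simp add: carrier_sum_group)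

lemma (in comm_group) generate_image_finprod:
  fixes I :: "'i set"
  assumes "finite I" and e: "e \<in> I \<rightarrow> carrier G" and "x \<in> generate G (e ` I)"
  shows "\<exists>k. x = (\<Otimes>i\<in>I. e i [^] (k i :: int))"
  using assms(3)
proof (induction rule: generate.induct)
  case one
  show ?case by (auto intro!: exI[of _ "\<lambda>_. 0"])
next
  have single: "\<exists>k. e j [^] c = (\<Otimes>i\<in>I. e i [^] (k i :: int))" if "j \<in> I" for j and c :: int
  proof
    have "(\<Otimes>i\<in>I. e i [^] (if i = j then c else 0)) = (\<Otimes>i\<in>I. if j = i then e i [^] c else \<one>)"
      using e by (intro finprod_cong') (auto simp: Pi_iff)
    then show "e j [^] c = (\<Otimes>i\<in>I. e i [^] (if i = j then c else 0))"
      using finprod_singleton[OF that assms(1), of "\<lambda>i. e i [^] c"] e by (simp add: Pi_iff)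
  qed
  case (incl h)
  then obtain j where "j \<in> I" "h = e j [^] (1 :: int)" using e by (auto simp: Pi_iff)
  then show ?case using single by metis
  case (inv h)
  then obtain j where j: "j \<in> I" "h = e j" by blast
  then have "e j \<in> carrier G" using e by auto
  then have "inv h = e j [^] (- 1 :: int)" using j by (simp add: int_pow_neg)
  then show ?case using single j by metis
next
  case (eng h1 h2)
  then obtain k1 k2 :: "'i \<Rightarrow> int" where
    "h1 = (\<Otimes>i\<in>I. e i [^] k1 i)" "h2 = (\<Otimes>i\<in>I. e i [^] k2 i)" by blast
  moreover have "(\<Otimes>i\<in>I. e i [^] (k1 i + k2 i)) = (\<Otimes>i\<in>I. e i [^] k1 i \<otimes> e i [^] k2 i)"
    using e by (intro finprod_cong') (auto simp: Pi_iff int_pow_mult)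
  ultimately have "h1 \<otimes> h2 = (\<Otimes>i\<in>I. e i [^] (k1 i + k2 i))"
    using e by (simp add: Pi_iff)
  then show ?case by (rule exI[of _ "\<lambda>i. k1 i + k2 i"])
qed

text \<open>The coordinates \<open>\<phi> i\<close> together map a product of powers of the
  \<open>e i\<close> to its exponents, each scaled by the unit \<open>\<phi> i (e i)\<close>. Units
  can be divided out, which gives surjectivity. If all coordinates vanish, each exponent is a
  multiple of \<open>m i\<close>, so by \<open>tors\<close> each factor is trivial. The diagonal
  values are allowed to be any units because the value 2 will occur for the elements
  \<open>tensor_sym G x x\<close>.\<close>

lemma (in comm_group) iso_sum_integer_mod_group:
  fixes I :: "'i set"
  assumes fin: "finite I" and e: "e \<in> I \<rightarrow> carrier G"
    and gen: "carrier G \<subseteq> generate G (e ` I)"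
    and tors: "\<And>i. i \<in> I \<Longrightarrow> e i [^] (m i :: nat) = \<one>"
    and hom: "\<And>i. i \<in> I \<Longrightarrow> \<phi> i \<in> hom G (integer_mod_group (m i))"
    and ortho: "\<And>i j. i \<in> I \<Longrightarrow> j \<in> I \<Longrightarrow> i \<noteq> j \<Longrightarrow> \<phi> i (e j) = 0"
    and unit: "\<And>i. i \<in> I \<Longrightarrow> coprime (\<phi> i (e i)) (int (m i))"
  shows "G \<cong> sum_group I (\<lambda>i. integer_mod_group (m i))"
proof -
  let ?S = "sum_group I (\<lambda>i. integer_mod_group (m i))"
  let ?\<Phi> = "\<lambda>x. \<lambda>i\<in>I. \<phi> i x"
  have car: "carrier ?S = (\<Pi>\<^sub>E i\<in>I. carrier (integer_mod_group (m i)))"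
    using fin by (simp add: carrier_sum_group_finite)
  have \<Phi>: "?\<Phi> \<in> hom G ?S"
  proof (rule homI)
    show "?\<Phi> x \<in> carrier ?S" if "x \<in> carrier G" for x
      using that hom by (auto simp: car intro: hom_carrier[THEN subsetD])
    show "?\<Phi> (x \<otimes> y) = ?\<Phi> x \<otimes>\<^bsub>?S\<^esub> ?\<Phi> y" if "x \<in> carrier G" "y \<in> carrier G" for x y
      using that by (auto simp: hom_mult[OF hom])
  qed
  have eval: "\<phi> i (\<Otimes>j\<in>I. e j [^] (k j :: int)) = (k i * \<phi> i (e i)) mod int (m i)"
    if i: "i \<in> I" for i k
  proof -
    interpret \<phi>: group_hom G "integer_mod_group (m i)" "\<phi> i"
      using hom[OF i] by (simp add: group_hom_def group_hom_axioms_def is_group)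
    have "finite F \<Longrightarrow> F \<subseteq> I \<Longrightarrow> \<phi> i (\<Otimes>j\<in>F. e j [^] k j) =
        (if i \<in> F then (k i * \<phi> i (e i)) mod int (m i) else 0)" for F
    proof (induction F rule: finite_induct)
      case (insert j F)
      then have "e j \<in> carrier G" "(\<lambda>j. e j [^] k j) \<in> F \<rightarrow> carrier G" using e by auto
      moreover from this have "(\<Otimes>j\<in>F. e j [^] k j) \<in> carrier G" by (intro finprod_closed)
      ultimately have *: "e j \<in> carrier G" "(\<lambda>j. e j [^] k j) \<in> F \<rightarrow> carrier G"
        "(\<Otimes>j\<in>F. e j [^] k j) \<in> carrier G" by auto
      have "\<phi> i (finprod G (\<lambda>j. e j [^] k j) (insert j F)) =
          (k j * \<phi> i (e j) + \<phi> i (\<Otimes>j\<in>F. e j [^] k j)) mod int (m i)"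
        using insert * by (simp add: \<phi>.hom_int_pow int_pow_integer_mod_group mod_add_left_eq)
      with insert i show ?case
        by (cases "i = j") (auto simp: ortho)
    qed (use \<phi>.hom_one in simp)
    from this[OF fin order.refl] i show ?thesis by simp
  qed
  interpret \<Phi>: group_hom G ?S ?\<Phi>
    using \<Phi> by (simp add: group_hom_def group_hom_axioms_def is_group)
  have "carrier ?S \<subseteq> ?\<Phi> ` carrier G"
  proof
    fix a assume a: "a \<in> carrier ?S"
    have "\<exists>c. (c * \<phi> i (e i)) mod int (m i) = a i" if i: "i \<in> I" for i
    proof -
      \<comment> \<open>The exponent of \<open>e i\<close> must be \<open>a i\<close> times an
        inverse of the unit \<open>\<phi> i (e i)\<close>.\<close>
      from cong_solve_coprime_int[OF unit[OF i]] obtain c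
        where "[\<phi> i (e i) * c = 1] (mod int (m i))" by blast
      then have "[a i * (\<phi> i (e i) * c) = a i * 1] (mod int (m i))" by (rule cong_scalar_left)
      moreover have "a i \<in> carrier (integer_mod_group (m i))" using a i by (auto simp: car)
      then have "a i mod int (m i) = a i"
        by (auto simp: carrier_integer_mod_group split: if_splits)
      ultimately show ?thesis
        by (intro exI[of _ "a i * c"]) (simp add: cong_def mult_ac)
    qed
    then obtain c where c: "\<And>i. i \<in> I \<Longrightarrow> (c i * \<phi> i (e i)) mod int (m i) = a i" by metis
    have "?\<Phi> (\<Otimes>j\<in>I. e j [^] c j) = a"
      using a by (auto simp: car eval c PiE_iff extensional_def)
    moreover have "(\<Otimes>j\<in>I. e j [^] c j) \<in> carrier G"
      using e by (intro finprod_closed) auto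
    ultimately show "a \<in> ?\<Phi> ` carrier G" by blast
  qed
  moreover have "x = \<one>" if x: "x \<in> carrier G" and one: "?\<Phi> x = \<one>\<^bsub>?S\<^esub>" for x
  proof -
    from generate_image_finprod[OF fin e] gen x
    obtain k :: "'i \<Rightarrow> int" where k: "x = (\<Otimes>j\<in>I. e j [^] k j)" by blast
    have "e j [^] k j = \<one>" if j: "j \<in> I" for j
    proof -
      have "\<phi> j x = 0" using fun_cong[OF one, of j] j by simp
      then have "int (m j) dvd k j"
        using eval[OF j, of k] unit[OF j] k by (simp add: coprime_commute coprime_dvd_mult_left_iff mod_eq_0_iff_dvd)
      then obtain l where "k j = int (m j) * l" by blast
      moreover have "e j [^] (int (m j) * l) = (e j [^] int (m j)) [^] l"
        using e j by (intro int_pow_pow[symmetric]) auto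
      ultimately show ?thesis using tors[OF j] by (simp add: int_pow_int)
    qed
    then show ?thesis using k by (simp add: finprod_one_eqI)
  qed
  ultimately show ?thesis
    using \<Phi>.iso_iff by (auto intro: is_isoI)
qed

lemma sum_group_iso_cyc_sum:
  assumes "finite I" "card I = r" "\<And>i. i \<in> I \<Longrightarrow> M i = m"
  shows "sum_group I (\<lambda>i. integer_mod_group (M i)) \<cong> cyc_sum m r"
proof -
  obtain h where h: "bij_betw h {..<r} I"
    using ex_bij_betw_nat_finite[OF assms(1)] assms(2) by (auto simp: atLeast0LessThan)
  let ?h' = "inv_into {..<r} h"
  have hI: "h i \<in> I" if "i < r" for i using h that by (auto simp: bij_betw_def)
  have h': "?h' i < r" "h (?h' i) = i" if "i \<in> I" for i
    using h that inv_into_into[of i h "{..<r}"] by (auto simp: bij_betw_def f_inv_into_f)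
  have h'': "?h' (h i) = i" if "i < r" for i
    using h that by (auto simp: bij_betw_def)
  let ?S = "sum_group I (\<lambda>i. integer_mod_group (M i))"
  have cS: "carrier ?S = (\<Pi>\<^sub>E i\<in>I. carrier (integer_mod_group m))"
    using assms by (simp add: carrier_sum_group_finite cong: PiE_cong)
  have cT: "carrier (cyc_sum m r) = (\<Pi>\<^sub>E i\<in>{..<r}. carrier (integer_mod_group m))"
    by (simp add: cyc_sum_def carrier_sum_group_finite)
  let ?\<Phi> = "\<lambda>f. \<lambda>i\<in>{..<r}. f (h i)" and ?\<Psi> = "\<lambda>f. \<lambda>i\<in>I. f (?h' i)"
  have "bij_betw ?\<Phi> (carrier ?S) (carrier (cyc_sum m r))"
    by (rule bij_betwI[where g = ?\<Psi>])
      (auto simp: cS cT hI h' h'' PiE_iff extensional_def fun_eq_iff)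
  moreover have "?\<Phi> \<in> hom ?S (cyc_sum m r)"
  proof (rule homI)
    show "?\<Phi> x \<in> carrier (cyc_sum m r)" if "x \<in> carrier ?S" for x
      using that hI by (auto simp: cS cT)
    show "?\<Phi> (x \<otimes>\<^bsub>?S\<^esub> y) = ?\<Phi> x \<otimes>\<^bsub>cyc_sum m r\<^esub> ?\<Phi> y" for x y
      using hI assms(3) by (auto simp: cyc_sum_def)
  qed
  ultimately show ?thesis by (intro is_isoI isoI)
qed

lemma sum_group_insert_iso:
  assumes "finite I" "i \<notin> I" "\<And>j. j \<in> insert i I \<Longrightarrow> group (F j)"
  shows "sum_group (insert i I) F \<cong> F i \<times>\<times> sum_group I F"
proof -
  let ?\<Phi> = "\<lambda>f. (f i, restrict f I)" and ?\<Psi> = "\<lambda>(a, f). \<lambda>j\<in>insert i I. if j = i then a else f j"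
  have cS: "carrier (sum_group (insert i I) F) = (\<Pi>\<^sub>E j\<in>insert i I. carrier (F j))"
    using assms by (intro carrier_sum_group_finite) auto
  have cT: "carrier (sum_group I F) = (\<Pi>\<^sub>E j\<in>I. carrier (F j))"
    using assms by (intro carrier_sum_group_finite) auto
  have "bij_betw ?\<Phi> (carrier (sum_group (insert i I) F)) (carrier (F i \<times>\<times> sum_group I F))"
    using assms(2) by (intro bij_betwI[where g = ?\<Psi>])
      (auto simp: cS cT PiE_iff extensional_def fun_eq_iff split: if_splits)
  moreover have "?\<Phi> \<in> hom (sum_group (insert i I) F) (F i \<times>\<times> sum_group I F)"
    by (rule homI) (auto simp: cS cT)
  ultimately show ?thesis by (intro is_isoI isoI)
qed

lemma DirProd_iso_cong_right:
  assumes "H \<cong> K"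
  shows "G \<times>\<times> H \<cong> G \<times>\<times> K"
proof -
  obtain h where "h \<in> hom H K" "bij_betw h (carrier H) (carrier K)"
    using assms by (auto simp: is_iso_def iso_def)
  then have "map_prod id h \<in> hom (G \<times>\<times> H) (G \<times>\<times> K)"
    "bij_betw (map_prod id h) (carrier (G \<times>\<times> H)) (carrier (G \<times>\<times> K))"
    by (auto simp: hom_def Pi_iff intro: bij_betw_map_prod)
  then show ?thesis by (intro is_isoI isoI)
qed

section \<open>The symmetric form on the group with values in the diagonal subgroup\<close>

definition tensor_sym :: "('a, 'm) monoid_scheme \<Rightarrow> 'a \<Rightarrow> 'a \<Rightarrow> ('a \<times> 'a) word set" where
  "tensor_sym G g h = tensor G g h \<otimes>\<^bsub>tensor_square G\<^esub> tensor G h g"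

context group
begin

lemma carrier_nabla:
  "carrier (nabla G) = generate (tensor_square G) {tensor G g g |g. g \<in> carrier G}"
  unfolding nabla_def carrier_subgroup_generated
  by (rule arg_cong[where f = "generate (tensor_square G)"]) auto

lemma carrier_nabla_subset: "carrier (nabla G) \<subseteq> carrier (tensor_square G)"
  unfolding nabla_def by (intro group.carrier_subgroup_generated_subset) simp

lemma mult_nabla [simp]: "(\<otimes>\<^bsub>nabla G\<^esub>) = (\<otimes>\<^bsub>tensor_square G\<^esub>)"
  by (simp add: nabla_def)

lemma one_nabla [simp]: "\<one>\<^bsub>nabla G\<^esub> = \<one>\<^bsub>tensor_square G\<^esub>"
  by (simp add: nabla_def)

lemma tensor_diag_in_nabla [simp]: "g \<in> carrier G \<Longrightarrow> tensor G g g \<in> carrier (nabla G)"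
  by (auto simp: carrier_nabla intro: generate.incl)

lemma group_nabla [simp]: "group (nabla G)"
  unfolding nabla_def by (intro group.group_subgroup_generated) simp

lemma nabla_central:
  assumes "z \<in> carrier (nabla G)" "t \<in> carrier (tensor_square G)"
  shows "z \<otimes>\<^bsub>tensor_square G\<^esub> t = t \<otimes>\<^bsub>tensor_square G\<^esub> z"
  using assms unfolding carrier_nabla
proof (induction rule: generate.induct)
  interpret T: group "tensor_square G" by simp
  case one
  then show ?case by simp
next
  case (incl h)
  then show ?case using tensor_diag_commute by auto
next
  case (inv h)
  interpret T: group "tensor_square G" by simp
  show ?case using inv tensor_diag_commute by (intro T.commute_inv) auto
next
  case (eng h1 h2)
  interpret T: group "tensor_square G" by simp
  have "h1 \<in> carrier (tensor_square G)" "h2 \<in> carrier (tensor_square G)"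
    using eng carrier_nabla_subset carrier_nabla by auto
  moreover have "h1 \<otimes>\<^bsub>tensor_square G\<^esub> t = t \<otimes>\<^bsub>tensor_square G\<^esub> h1"
    "h2 \<otimes>\<^bsub>tensor_square G\<^esub> t = t \<otimes>\<^bsub>tensor_square G\<^esub> h2"
    using eng by auto
  ultimately show ?case
    using eng.prems by (simp add: T.m_assoc) (simp flip: T.m_assoc)
qed

lemma comm_group_nabla [simp]: "comm_group (nabla G)"
  using nabla_central carrier_nabla_subset
  by (intro group.group_comm_groupI) auto

text \<open>Thus \<open>tensor_sym\<close> is the polarisation of the quadratic map
  \<open>tensor G g g\<close>. Writing the product \<open>g \<otimes> h\<close> as
  \<open>h \<otimes> x\<close>, with \<open>x\<close> a conjugate of \<open>g\<close>, makes both
  expansions end in symbols in \<open>g\<close> and \<open>h\<close> alone; the only other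
  conjugates are diagonal and disappear by \<open>tensor_diag_conjg\<close>. The two diagonal
  factors are then moved past the last symbol.\<close>

lemma tensor_diag_mult:
  assumes g: "g \<in> carrier G" and h: "h \<in> carrier G"
  shows "tensor G (g \<otimes> h) (g \<otimes> h) =
    tensor_sym G g h \<otimes>\<^bsub>nabla G\<^esub> (tensor G g g \<otimes>\<^bsub>nabla G\<^esub> tensor G h h)"
proof -
  interpret T: group "tensor_square G" by simp
  define x where "x = conjg G (inv h) g"
  have x: "x \<in> carrier G" "conjg G h x = g" using g h by (simp_all add: x_def conjg_conjg)
  then have gh: "g \<otimes> h = h \<otimes> x" using h by (auto simp: conjg_def m_assoc)
  have "tensor G (h \<otimes> x) (h \<otimes> x) = tensor G (conjg G h x) (conjg G h (h \<otimes> x)) \<otimes>\<^bsub>tensor_square G\<^esub>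
      tensor G h (h \<otimes> x)"
    using h x by (simp add: tensor_mult_left)
  also have "conjg G h (h \<otimes> x) = h \<otimes> g" using h x by (simp add: conjg_mult)
  also have "conjg G h x = g" by fact
  also have "tensor G g (h \<otimes> g) = tensor G g h \<otimes>\<^bsub>tensor_square G\<^esub> tensor G g g"
    using g h by (simp add: tensor_mult_right tensor_diag_conjg)
  also have "tensor G h (h \<otimes> x) = tensor G h h \<otimes>\<^bsub>tensor_square G\<^esub> tensor G h g"
    using h x by (simp add: tensor_mult_right)
  also have "tensor G g h \<otimes>\<^bsub>tensor_square G\<^esub> tensor G g g \<otimes>\<^bsub>tensor_square G\<^esub>
      (tensor G h h \<otimes>\<^bsub>tensor_square G\<^esub> tensor G h g) =
    tensor G g h \<otimes>\<^bsub>tensor_square G\<^esub> ((tensor G g g \<otimes>\<^bsub>tensor_square G\<^esub> tensor G h h)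
      \<otimes>\<^bsub>tensor_square G\<^esub> tensor G h g)"
    using g h by (simp add: T.m_assoc)
  also have "(tensor G g g \<otimes>\<^bsub>tensor_square G\<^esub> tensor G h h) \<otimes>\<^bsub>tensor_square G\<^esub> tensor G h g =
     tensor G h g \<otimes>\<^bsub>tensor_square G\<^esub> (tensor G g g \<otimes>\<^bsub>tensor_square G\<^esub> tensor G h h)"
    using g h group.is_monoid[OF group_nabla, THEN monoid.m_closed, of "tensor G g g" "tensor G h h"]
    by (intro nabla_central) auto
  finally show ?thesis using g h by (simp add: gh tensor_sym_def T.m_assoc)
qed

text \<open>Solve \<open>tensor_diag_mult\<close> for the form: it is a quotient of diagonal
  elements.\<close>

lemma tensor_sym_in_nabla [simp]:
  assumes g: "g \<in> carrier G" and h: "h \<in> carrier G"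
  shows "tensor_sym G g h \<in> carrier (nabla G)"
proof -
  interpret T: group "tensor_square G" by simp
  interpret N: comm_group "nabla G" by simp
  let ?z = "tensor G g g \<otimes>\<^bsub>nabla G\<^esub> tensor G h h"
  have z: "?z \<in> carrier (nabla G)" using g h by (intro N.m_closed) auto
  have "tensor_sym G g h \<in> carrier (tensor_square G)" using g h by (simp add: tensor_sym_def)
  then have "tensor_sym G g h = tensor G (g \<otimes> h) (g \<otimes> h) \<otimes>\<^bsub>tensor_square G\<^esub> inv\<^bsub>tensor_square G\<^esub> ?z"
    using tensor_diag_mult[OF g h] g h by (simp add: T.inv_solve_right)
  also have "inv\<^bsub>tensor_square G\<^esub> ?z = inv\<^bsub>nabla G\<^esub> ?z"
    using T.inv_subgroup_generated z by (simp add: nabla_def)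
  finally show ?thesis
    using N.m_closed[of "tensor G (g \<otimes> h) (g \<otimes> h)" "inv\<^bsub>nabla G\<^esub> ?z"] g h z by simp
qed

text \<open>Compare \<open>tensor_diag_mult\<close> for a pair and for the conjugated pair. All
  diagonal elements agree by \<open>tensor_diag_conjg\<close>, so they can be cancelled.\<close>

lemma tensor_sym_conjg:
  assumes "x \<in> carrier G" "g \<in> carrier G" "h \<in> carrier G"
  shows "tensor_sym G (conjg G x g) (conjg G x h) = tensor_sym G g h"
proof -
  interpret N: comm_group "nabla G" by simp
  have "tensor_sym G (conjg G x g) (conjg G x h) \<otimes>\<^bsub>nabla G\<^esub> (tensor G g g \<otimes>\<^bsub>nabla G\<^esub> tensor G h h) =
    tensor_sym G g h \<otimes>\<^bsub>nabla G\<^esub> (tensor G g g \<otimes>\<^bsub>nabla G\<^esub> tensor G h h)"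
    using tensor_diag_mult[of "conjg G x g" "conjg G x h"] tensor_diag_mult[of g h] assms
    by (simp add: tensor_diag_conjg flip: conjg_mult)
  then show ?thesis
    using assms by (subst (asm) N.right_cancel) (simp_all del: mult_nabla)
qed

text \<open>The products \<open>g \<otimes> h\<close> and \<open>h \<otimes> g\<close> are conjugate
  and so have the same diagonal element; cancel the diagonal factors in
  \<open>tensor_diag_mult\<close> for both orders.\<close>

lemma tensor_sym_commute:
  assumes "g \<in> carrier G" "h \<in> carrier G"
  shows "tensor_sym G g h = tensor_sym G h g"
proof -
  interpret N: comm_group "nabla G" by simp
  have "h \<otimes> g = conjg G h (g \<otimes> h)" using assms by (simp add: conjg_def m_assoc)
  then have "tensor_sym G h g \<otimes>\<^bsub>nabla G\<^esub> (tensor G h h \<otimes>\<^bsub>nabla G\<^esub> tensor G g g) =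
    tensor_sym G g h \<otimes>\<^bsub>nabla G\<^esub> (tensor G g g \<otimes>\<^bsub>nabla G\<^esub> tensor G h h)"
    using tensor_diag_mult[of g h] tensor_diag_mult[of h g] assms
    by (simp add: tensor_diag_conjg)
  also have "tensor G g g \<otimes>\<^bsub>nabla G\<^esub> tensor G h h = tensor G h h \<otimes>\<^bsub>nabla G\<^esub> tensor G g g"
    using assms by (intro N.m_comm) auto
  finally show ?thesis
    using assms by (subst (asm) N.right_cancel) (simp_all del: mult_nabla)
qed

text \<open>Expanding both symbols encloses \<open>tensor_sym G x h\<close> between two symbols in
  conjugates of \<open>y\<close> and \<open>h\<close>. The inner value is central and can be moved
  out, and the outer pair is \<open>tensor_sym G y h\<close> by invariance under conjugation. As the
  target is abelian, the form sees its arguments only modulo commutators.\<close>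

lemma tensor_sym_hom:
  assumes h: "h \<in> carrier G"
  shows "(\<lambda>g. tensor_sym G g h) \<in> hom G (nabla G)"
proof (rule homI)
  interpret T: group "tensor_square G" by simp
  fix x y assume x: "x \<in> carrier G" and y: "y \<in> carrier G"
  have "tensor_sym G (x \<otimes> y) h =
      tensor G (conjg G x y) (conjg G x h) \<otimes>\<^bsub>tensor_square G\<^esub>
      (tensor_sym G x h \<otimes>\<^bsub>tensor_square G\<^esub> tensor G (conjg G x h) (conjg G x y))"
    using x y h by (simp add: tensor_sym_def tensor_mult_left tensor_mult_right T.m_assoc)
  also have "tensor_sym G x h \<otimes>\<^bsub>tensor_square G\<^esub> tensor G (conjg G x h) (conjg G x y) =
      tensor G (conjg G x h) (conjg G x y) \<otimes>\<^bsub>tensor_square G\<^esub> tensor_sym G x h"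
    using x y h by (intro nabla_central) auto
  also have "tensor G (conjg G x y) (conjg G x h) \<otimes>\<^bsub>tensor_square G\<^esub> \<dots> =
      tensor_sym G (conjg G x y) (conjg G x h) \<otimes>\<^bsub>tensor_square G\<^esub> tensor_sym G x h"
    using x y h carrier_nabla_subset tensor_sym_in_nabla[of x h]
    by (simp add: tensor_sym_def[of _ "conjg G x y"] T.m_assoc subset_iff)
  also have "\<dots> = tensor_sym G x h \<otimes>\<^bsub>tensor_square G\<^esub> tensor_sym G y h"
    using x y h carrier_nabla_subset tensor_sym_in_nabla[of y h]
    by (simp add: tensor_sym_conjg nabla_central subset_iff)
  finally show "tensor_sym G (x \<otimes> y) h = tensor_sym G x h \<otimes>\<^bsub>nabla G\<^esub> tensor_sym G y h" by simp
qed (use h in simp)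

text \<open>The diagonal element of \<open>x\<close> is a power of \<open>tensor_sym G x x\<close>, its square, because its order
  is odd.\<close>

lemma tensor_diag_in_subgroup:
  assumes "odd (order G)" "x \<in> carrier G" "subgroup E (nabla G)" "tensor_sym G x x \<in> E"
  shows "tensor G x x \<in> E"
proof -
  interpret T: group "tensor_square G" by simp
  interpret N: comm_group "nabla G" by simp
  let ?q = "tensor G x x"
  interpret b: group_hom G "nabla G" "\<lambda>g. tensor_sym G g x"
    using tensor_sym_hom[OF assms(2)] by unfold_locales
  have sq: "tensor_sym G x x = ?q [^]\<^bsub>nabla G\<^esub> (2::nat)"
    using assms(2) by (simp add: tensor_sym_def numeral_2_eq_2)
  \<comment> \<open>The exponent is quadratic: passing from \<open>n\<close> to \<open>n + 1\<close>
    adds \<open>2 * n\<close> from the form and 1 from the new diagonal factor.\<close>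
  have sq_pow: "tensor G (x [^] n) (x [^] n) = ?q [^]\<^bsub>nabla G\<^esub> (n\<^sup>2)" for n :: nat
  proof (induction n)
    case (Suc n)
    have "tensor_sym G (x [^] n) x = ?q [^]\<^bsub>nabla G\<^esub> (2 * n)"
      using assms(2) b.hom_nat_pow[of x n] by (simp add: sq N.nat_pow_pow)
    then have "tensor G (x [^] Suc n) (x [^] Suc n) = ?q [^]\<^bsub>nabla G\<^esub> (2 * n) \<otimes>\<^bsub>nabla G\<^esub>
        (?q [^]\<^bsub>nabla G\<^esub> (n\<^sup>2) \<otimes>\<^bsub>nabla G\<^esub> ?q [^]\<^bsub>nabla G\<^esub> (1::nat))"
      using assms(2) Suc by (simp add: tensor_diag_mult)
    also have "\<dots> = ?q [^]\<^bsub>nabla G\<^esub> ((Suc n)\<^sup>2)"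
    proof -
      have "2 * n + (n\<^sup>2 + 1) = (Suc n)\<^sup>2" by (simp add: power2_eq_square)
      then show ?thesis using assms(2) by (simp only: N.nat_pow_mult tensor_diag_in_nabla)
    qed
    finally show ?case .
  qed (use assms(2) in simp)
  let ?m = "order G"
  have "finite (carrier G)" using assms(1) by (metis card.infinite even_zero order_def)
  \<comment> \<open>Since \<open>x\<close> to the power \<open>?m\<close> is trivial, the power of
    \<open>?q\<close> with exponent the square of \<open>?m\<close> is trivial. Writing this odd
    exponent as \<open>2 * k + 1\<close> exhibits \<open>?q\<close> as the inverse of the
    \<open>k\<close>-th power of \<open>tensor_sym G x x\<close>.\<close>
  then have "?q [^]\<^bsub>nabla G\<^esub> (?m\<^sup>2) = \<one>\<^bsub>nabla G\<^esub>"
    using sq_pow[of ?m] assms(2) pow_order_eq_1 by simp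
  moreover have "odd (?m\<^sup>2)" using assms(1) by simp
  then obtain k where "?m\<^sup>2 = 2 * k + 1" by (rule oddE)
  ultimately have "?q [^]\<^bsub>nabla G\<^esub> (2 * k) \<otimes>\<^bsub>nabla G\<^esub> ?q = \<one>\<^bsub>nabla G\<^esub>"
    by simp
  then have "?q = inv\<^bsub>nabla G\<^esub> (tensor_sym G x x [^]\<^bsub>nabla G\<^esub> k)"
    using assms(2) N.inv_equality[of "?q" "?q [^]\<^bsub>nabla G\<^esub> (2 * k)"] N.m_comm[of ?q "?q [^]\<^bsub>nabla G\<^esub> (2 * k)"]
    by (simp add: sq N.nat_pow_pow del: mult_nabla)
  moreover have "tensor_sym G x x [^]\<^bsub>nabla G\<^esub> k \<in> E"
    using assms(3,4) N.subgroup_int_pow_closed[of E _ "int k"] by (simp add: int_pow_int)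
  ultimately show ?thesis
    using assms(3) by (metis subgroup.m_inv_closed)
qed

lemma hom_image_subset_subgroup:
  assumes "f \<in> hom G H" "group H" "subgroup E H"
    and "g ` J \<subseteq> carrier G" "generate G (g ` J) = carrier G" "\<And>j. j \<in> J \<Longrightarrow> f (g j) \<in> E"
  shows "x \<in> carrier G \<Longrightarrow> f x \<in> E"
proof -
  interpret f: group_hom G H f
    using assms by (simp add: group_hom_def group_hom_axioms_def)
  assume "x \<in> carrier G"
  then have "f x \<in> f ` generate G (g ` J)" using assms by simp
  also have "f ` generate G (g ` J) = generate H (f ` g ` J)"
    using f.generate_img[OF assms(4)] by simp
  also have "\<dots> \<subseteq> E"
    using assms by (intro group.generate_subgroup_incl) auto
  finally show ?thesis .
qed

text \<open>The family \<open>g\<close> generates the whole group, while the smaller family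
  \<open>x\<close> need only generate it modulo commutators. The latter is expressed by
  \<open>gen\<close> through homomorphisms into the abelian group \<open>nabla G\<close>, and the
  maps \<open>tensor_sym G _ h\<close> are such homomorphisms, so the arguments of the form can be
  reduced one at a time.\<close>

lemma carrier_nabla_eq_generate:
  assumes odd: "odd (order G)"
    and g: "g ` J \<subseteq> carrier G" "generate G (g ` J) = carrier G"
    and x: "x ` I \<subseteq> carrier G"
    and gen: "\<And>\<psi> j. \<psi> \<in> hom G (nabla G) \<Longrightarrow> j \<in> J \<Longrightarrow> \<psi> (g j) \<in> generate (nabla G) (\<psi> ` x ` I)"
  shows "carrier (nabla G) = generate (nabla G) {tensor_sym G (x i) (x k) |i k. i \<in> I \<and> k \<in> I}"
    (is "_ = generate _ ?B")
proof
  interpret T: group "tensor_square G" by simp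
  interpret N: comm_group "nabla G" by simp
  let ?E = "generate (nabla G) ?B"
  have xc: "x i \<in> carrier G" if "i \<in> I" for i using x that by auto
  then have B: "?B \<subseteq> carrier (nabla G)" by auto
  then have E: "subgroup ?E (nabla G)" by (rule N.generate_is_subgroup)
  show "?E \<subseteq> carrier (nabla G)" using B by (rule N.generate_incl)
  have reduce: "tensor_sym G y h \<in> ?E"
    if "h \<in> carrier G" "\<And>i. i \<in> I \<Longrightarrow> tensor_sym G (x i) h \<in> ?E" "y \<in> carrier G" for h y
  proof (rule hom_image_subset_subgroup[OF tensor_sym_hom[OF that(1)] _ E g _ that(3)])
    fix j assume "j \<in> J"
    then have "tensor_sym G (g j) h \<in> generate (nabla G) ((\<lambda>y. tensor_sym G y h) ` x ` I)"
      using gen[OF tensor_sym_hom[OF that(1)]] by simp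
    also have "\<dots> \<subseteq> ?E"
      using that(2) by (intro N.generate_subgroup_incl E) auto
    finally show "tensor_sym G (g j) h \<in> ?E" .
  qed simp
  \<comment> \<open>First \<open>reduce\<close> with the second argument among the
    \<open>x k\<close>. Symmetry turns this into the premise of \<open>reduce\<close> for an
    arbitrary second argument.\<close>
  have left: "tensor_sym G y (x k) \<in> ?E" if "k \<in> I" "y \<in> carrier G" for k y
  proof (rule reduce[OF xc _ that(2)])
    show "tensor_sym G (x i) (x k) \<in> ?E" if "i \<in> I" for i
      using that \<open>k \<in> I\<close> by (intro generate.incl) blast
  qed fact
  have "tensor_sym G y h \<in> ?E" if "h \<in> carrier G" "y \<in> carrier G" for h y
  proof (rule reduce[OF that(1) _ that(2)])
    show "tensor_sym G (x i) h \<in> ?E" if "i \<in> I" for i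
      using left[OF that \<open>h \<in> carrier G\<close>] tensor_sym_commute[OF xc[OF that] \<open>h \<in> carrier G\<close>] by simp
  qed
  then have "tensor G y y \<in> ?E" if "y \<in> carrier G" for y
    using tensor_diag_in_subgroup[OF odd _ E] that by simp
  moreover have "subgroup ?E (tensor_square G)"
    using E T.subgroup_subgroup_generated_iff by (simp add: nabla_def)
  ultimately show "carrier (nabla G) \<subseteq> ?E"
    unfolding carrier_nabla by (intro T.generate_subgroup_incl) auto
qed

text \<open>Homomorphisms into an abelian group do not see conjugation, so both families of tensor
  relations turn into additivity in one argument. The divisibility of \<open>m1\<close> and
  \<open>m2\<close> by \<open>m\<close> makes both factors well behaved modulo
  \<open>m\<close>.\<close>

lemma tensor_square_bilinear_hom:
  assumes "\<chi> \<in> hom G (integer_mod_group m1)" "\<chi>' \<in> hom G (integer_mod_group m2)" "m dvd m1" "m dvd m2"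
  obtains \<phi> where "\<phi> \<in> hom (tensor_square G) (integer_mod_group m)"
    and "\<And>g h. g \<in> carrier G \<Longrightarrow> h \<in> carrier G \<Longrightarrow> \<phi> (tensor G g h) = (\<chi> g * \<chi>' h) mod int m"
proof -
  have add: "[f (g \<otimes> h) = f g + f h] (mod int m)"
    and conj: "[f (conjg G g h) = f h] (mod int m)"
    if f: "f \<in> hom G (integer_mod_group n)" "m dvd n" and gh: "g \<in> carrier G" "h \<in> carrier G"
    for f n g h
  proof -
    have *: "[f (x \<otimes> y) = f x + f y] (mod int m)" if "x \<in> carrier G" "y \<in> carrier G" for x y
      using hom_mult[OF f(1) that] f(2) by (simp add: cong_def mod_mod_cancel)
    then show "[f (g \<otimes> h) = f g + f h] (mod int m)" using gh by simp
    \<comment> \<open>In this form the invariance under conjugation follows by cancelling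
      \<open>f g\<close>, without computing the value of \<open>f\<close> at an inverse.\<close>
    have "conjg G g h \<otimes> g = g \<otimes> h" using gh by (simp add: conjg_def m_assoc)
    then have "[f (conjg G g h) + f g = f g + f h] (mod int m)"
      using *[of "conjg G g h" g] *[of g h] gh by (metis cong_sym cong_trans conjg_closed)
    then show "[f (conjg G g h) = f h] (mod int m)"
      by (simp add: add.commute[of "f g"] cong_add_rcancel)
  qed
  let ?f = "\<lambda>(g, h). (\<chi> g * \<chi>' h) mod int m"
  have f: "?f \<in> carrier G \<times> carrier G \<rightarrow> carrier (integer_mod_group m)"
    by (auto simp: carrier_integer_mod_group)
  have "weval (integer_mod_group m) ?f u = weval (integer_mod_group m) ?f v"
    if "(u, v) \<in> tensor_rels G" for u v
  proof -
    note add1 = add[OF assms(1,3)] and add2 = add[OF assms(2,4)]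
      and conj1 = conj[OF assms(1,3), THEN cong_sym] and conj2 = conj[OF assms(2,4), THEN cong_sym]
    have *: "[\<chi> (g \<otimes> g') * \<chi>' h = \<chi> (conjg G g g') * \<chi>' (conjg G g h) + \<chi> g * \<chi>' h] (mod int m)"
      if "g \<in> carrier G" "g' \<in> carrier G" "h \<in> carrier G" for g g' h
    proof -
      have "[\<chi> (g \<otimes> g') * \<chi>' h = (\<chi> g + \<chi> g') * \<chi>' h] (mod int m)"
        using that by (intro cong_mult add1 add2 cong_refl)
      also have "(\<chi> g + \<chi> g') * \<chi>' h = \<chi> g' * \<chi>' h + \<chi> g * \<chi>' h" by (simp add: algebra_simps)
      also have "[\<dots> = \<chi> (conjg G g g') * \<chi>' (conjg G g h) + \<chi> g * \<chi>' h] (mod int m)"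
        using that by (intro cong_mult cong_add cong_refl conj1 conj2)
      finally show ?thesis .
    qed
    have **: "[\<chi> g * \<chi>' (h \<otimes> h') = \<chi> g * \<chi>' h + \<chi> (conjg G h g) * \<chi>' (conjg G h h')] (mod int m)"
      if "g \<in> carrier G" "h \<in> carrier G" "h' \<in> carrier G" for g h h'
    proof -
      have "[\<chi> g * \<chi>' (h \<otimes> h') = \<chi> g * (\<chi>' h + \<chi>' h')] (mod int m)"
        using that by (intro cong_mult add1 add2 cong_refl)
      also have "\<chi> g * (\<chi>' h + \<chi>' h') = \<chi> g * \<chi>' h + \<chi> g * \<chi>' h'" by (simp add: algebra_simps)
      also have "[\<dots> = \<chi> g * \<chi>' h + \<chi> (conjg G h g) * \<chi>' (conjg G h h')] (mod int m)"
        using that by (intro cong_mult cong_add cong_refl conj1 conj2)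
      finally show ?thesis .
    qed
    show ?thesis
      using that * ** by (auto simp: tensor_rels_def letter_def cong_def mod_simps)
  qed
  from presented_group_hom[OF group_integer_mod_group f this]
  obtain \<phi> where \<phi>: "\<phi> \<in> hom (tensor_square G) (integer_mod_group m)"
    "\<And>u. u \<in> words (carrier G \<times> carrier G) \<Longrightarrow>
      \<phi> (word_class (carrier G \<times> carrier G) (tensor_rels G) u) = weval (integer_mod_group m) ?f u"
    unfolding tensor_square_def by blast
  then have "\<phi> (tensor G g h) = (\<chi> g * \<chi>' h) mod int m"
    if "g \<in> carrier G" "h \<in> carrier G" for g h
    using that unfolding tensor_def by (simp add: \<phi>(2)) (simp add: letter_def)
  with \<phi>(1) show thesis by (rule that)
qed

text \<open>The elements \<open>tensor_sym G (x i) (x j)\<close> with \<open>i \<le> j\<close>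
  generate, and the bilinear characters built from \<open>\<chi> i\<close> and
  \<open>\<chi> j\<close> are coordinates for them, so \<open>iso_sum_integer_mod_group\<close>
  applies. The hypotheses \<open>gen\<close> and \<open>tors\<close> describe the abelianisation
  only through its homomorphisms to \<open>nabla G\<close>, and \<open>dual\<close> provides
  coordinates on it.\<close>

theorem nabla_iso_sum_group:
  fixes d :: nat and n :: "nat \<Rightarrow> nat"
  assumes odd: "odd (order G)"
    and g: "g ` J \<subseteq> carrier G" "generate G (g ` J) = carrier G"
    and x: "x ` {..<d} \<subseteq> carrier G"
    and n: "\<And>i. i < d \<Longrightarrow> odd (n i)"
    and gen: "\<And>\<psi> j. \<psi> \<in> hom G (nabla G) \<Longrightarrow> j \<in> J \<Longrightarrow>
      \<psi> (g j) \<in> generate (nabla G) (\<psi> ` x ` {..<d})"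
    and tors: "\<And>\<psi> i. \<psi> \<in> hom G (nabla G) \<Longrightarrow> i < d \<Longrightarrow> \<psi> (x i) [^]\<^bsub>nabla G\<^esub> (n i :: nat) = \<one>\<^bsub>nabla G\<^esub>"
    and \<chi>: "\<And>i. i < d \<Longrightarrow> \<chi> i \<in> hom G (integer_mod_group (n i))"
    and dual: "\<And>i j. i < d \<Longrightarrow> j < d \<Longrightarrow> [\<chi> i (x j) = (if i = j then 1 else 0)] (mod int (n i))"
  shows "nabla G \<cong> sum_group {(i, j). i \<le> j \<and> j < d}
    (\<lambda>ij. integer_mod_group (gcd (n (fst ij)) (n (snd ij))))"
proof -
  interpret T: group "tensor_square G" by simp
  interpret N: comm_group "nabla G" by simp
  let ?I = "{(i, j). i \<le> j \<and> j < d}"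
  let ?e = "\<lambda>(i, j). tensor_sym G (x i) (x j)"
  let ?m = "\<lambda>(i, j). gcd (n i) (n j)"
  have xc: "x i \<in> carrier G" if "i < d" for i using x that by auto
  have "\<forall>ij\<in>?I. \<exists>\<phi>. \<phi> \<in> hom (tensor_square G) (integer_mod_group (?m ij)) \<and>
      (\<forall>g\<in>carrier G. \<forall>h\<in>carrier G.
        \<phi> (tensor G g h) = (\<chi> (fst ij) g * \<chi> (snd ij) h) mod int (?m ij))"
  proof
    fix ij assume "ij \<in> ?I"
    then obtain i j where ij: "ij = (i, j)" and lt: "i < d" "j < d" by auto
    obtain \<phi> where "\<phi> \<in> hom (tensor_square G) (integer_mod_group (gcd (n i) (n j)))"
      "\<And>g h. g \<in> carrier G \<Longrightarrow> h \<in> carrier G \<Longrightarrow>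
        \<phi> (tensor G g h) = (\<chi> i g * \<chi> j h) mod int (gcd (n i) (n j))"
      by (rule tensor_square_bilinear_hom[OF \<chi>[OF lt(1)] \<chi>[OF lt(2)] gcd_dvd1 gcd_dvd2]) blast
    then show "\<exists>\<phi>. \<phi> \<in> hom (tensor_square G) (integer_mod_group (?m ij)) \<and>
      (\<forall>g\<in>carrier G. \<forall>h\<in>carrier G.
        \<phi> (tensor G g h) = (\<chi> (fst ij) g * \<chi> (snd ij) h) mod int (?m ij))"
      unfolding ij by auto
  qed
  from bchoice[OF this] obtain \<phi> where
    \<phi>: "\<And>ij. ij \<in> ?I \<Longrightarrow> \<phi> ij \<in> hom (tensor_square G) (integer_mod_group (?m ij))"
    "\<And>ij g h. ij \<in> ?I \<Longrightarrow> g \<in> carrier G \<Longrightarrow> h \<in> carrier G \<Longrightarrow>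
      \<phi> ij (tensor G g h) = (\<chi> (fst ij) g * \<chi> (snd ij) h) mod int (?m ij)"
    by blast
  have \<phi>e: "\<phi> ij (?e kl) = (if ij = kl then if fst ij = snd ij then 2 else 1 else 0) mod int (?m ij)"
    if ij: "ij \<in> ?I" and kl: "kl \<in> ?I" for ij kl
  proof -
    obtain i j k l where [simp]: "ij = (i, j)" "kl = (k, l)" by fastforce
    have lt: "i \<le> j" "k \<le> l" "i < d" "j < d" "k < d" "l < d" using ij kl by auto
    let ?\<delta> = "\<lambda>a b. (if a = (b::nat) then 1 else 0) :: int"
    have \<chi>x: "[\<chi> i (x a) = ?\<delta> i a] (mod int (?m ij))" "[\<chi> j (x a) = ?\<delta> j a] (mod int (?m ij))"
      if "a < d" for a
      using cong_dvd_modulus[OF dual[of i a], of "int (?m ij)"]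
        cong_dvd_modulus[OF dual[of j a], of "int (?m ij)"] lt that by simp_all
    have "\<phi> ij (?e kl) = (\<phi> ij (tensor G (x k) (x l)) + \<phi> ij (tensor G (x l) (x k))) mod int (?m ij)"
      using hom_mult[OF \<phi>(1)[OF ij], of "tensor G (x k) (x l)" "tensor G (x l) (x k)"] lt xc
      by (simp add: tensor_sym_def)
    also have "\<dots> = (\<chi> i (x k) * \<chi> j (x l) + \<chi> i (x l) * \<chi> j (x k)) mod int (?m ij)"
      using \<phi>(2)[OF ij] lt xc by (simp add: mod_simps)
    also have "\<dots> = (?\<delta> i k * ?\<delta> j l + ?\<delta> i l * ?\<delta> j k) mod int (?m ij)"
      unfolding cong_def[symmetric] using lt by (intro cong_add cong_mult \<chi>x) auto
    \<comment> \<open>As both pairs are ordered, the second summand is nonzero only if all four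
      indices coincide; there both summands are 1, which is the source of the value 2.\<close>
    also have "?\<delta> i k * ?\<delta> j l + ?\<delta> i l * ?\<delta> j k = (if ij = kl then if fst ij = snd ij then 2 else 1 else 0)"
      using lt by auto
    finally show ?thesis .
  qed
  have "nabla G \<cong> sum_group ?I (\<lambda>ij. integer_mod_group (?m ij))"
  proof (rule N.iso_sum_integer_mod_group[where e = ?e and \<phi> = \<phi>])
    have "?I \<subseteq> {..<d} \<times> {..<d}" by auto
    then show "finite ?I" by (rule finite_subset) simp
    show "?e \<in> ?I \<rightarrow> carrier (nabla G)" using xc by auto
    have "{tensor_sym G (x i) (x k) |i k. i \<in> {..<d} \<and> k \<in> {..<d}} \<subseteq> ?e ` ?I"
    proof
      fix t assume "t \<in> {tensor_sym G (x i) (x k) |i k. i \<in> {..<d} \<and> k \<in> {..<d}}"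
      then obtain i k where t: "t = tensor_sym G (x i) (x k)" and ik: "i < d" "k < d" by blast
      then have "t = ?e (if i \<le> k then (i, k) else (k, i))"
        using tensor_sym_commute[OF xc xc] by simp
      moreover have "(if i \<le> k then (i, k) else (k, i)) \<in> ?I" using ik by auto
      ultimately show "t \<in> ?e ` ?I" by (rule image_eqI)
    qed
    then show "carrier (nabla G) \<subseteq> generate (nabla G) (?e ` ?I)"
      using carrier_nabla_eq_generate[OF odd g x gen] N.mono_generate by simp
    \<comment> \<open>The form is a homomorphism in each argument, so both \<open>n i\<close> and
      \<open>n j\<close> kill this value, and hence so does their gcd.\<close>
    show "?e ij [^]\<^bsub>nabla G\<^esub> ?m ij = \<one>\<^bsub>nabla G\<^esub>" if "ij \<in> ?I" for ij
    proof -
      obtain i j where [simp]: "ij = (i, j)" by fastforce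
      have lt: "i < d" "j < d" using that by auto
      have "?e ij [^]\<^bsub>nabla G\<^esub> n i = \<one>\<^bsub>nabla G\<^esub>"
        using tors[OF tensor_sym_hom[OF xc[of j]], of i] lt by simp
      moreover have "?e ij [^]\<^bsub>nabla G\<^esub> n j = \<one>\<^bsub>nabla G\<^esub>"
        using tors[OF tensor_sym_hom[OF xc[of i]], of j] lt xc tensor_sym_commute[of "x i" "x j"] by simp
      ultimately show ?thesis
        using lt xc by (simp add: N.pow_eq_id del: one_nabla)
    qed
    show "\<phi> ij \<in> hom (nabla G) (integer_mod_group (?m ij))" if "ij \<in> ?I" for ij
      unfolding nabla_def using \<phi>(1)[OF that] by (rule T.hom_from_subgroup_generated)
    show "\<phi> ij (?e kl) = 0" if "ij \<in> ?I" "kl \<in> ?I" "ij \<noteq> kl" for ij kl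
      using \<phi>e[OF that(1,2)] that(3) by simp
    show "coprime (\<phi> ij (?e ij)) (int (?m ij))" if ij: "ij \<in> ?I" for ij
    proof -
      \<comment> \<open>Oddness of the modulus is what makes the diagonal value 2 a unit.\<close>
      have "odd (?m ij)" using n ij by (auto intro: dvd_trans)
      then have "coprime (if fst ij = snd ij then 2 else 1 :: int) (int (?m ij))" by auto
      moreover have "int (?m ij) \<noteq> 0" using \<open>odd (?m ij)\<close> by (metis even_zero of_nat_eq_0_iff)
      ultimately show ?thesis
        unfolding \<phi>e[OF ij ij] by (subst coprime_mod_left_iff) simp_all
    qed
  qed
  then show ?thesis by (simp add: case_prod_unfold)
qed

end

subsection \<open>Groups with a polycyclic presentation\<close>

text \<open>In an abelian group a commutator is trivial, so each commutator relation says that its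
  right-hand side is trivial. For a commutative group \<open>A\<close> and right-hand sides over the
  five generators, the \<open>y\<close> with this property are the images of the generators under
  the homomorphisms from the presented group to \<open>A\<close>; this replaces the
  abelianisation.\<close>

definition ab_rels ::
  "('b, 'm) monoid_scheme \<Rightarrow> nat \<Rightarrow> ((nat \<times> nat) \<times> nat word) list \<Rightarrow> (nat \<times> nat word) list \<Rightarrow>
    (nat \<Rightarrow> 'b) \<Rightarrow> bool" where
  "ab_rels A p C P y \<longleftrightarrow> y \<in> {1..5} \<rightarrow> carrier A \<and>
    (\<forall>i\<in>{1..5}. \<forall>j\<in>{1..5}. j < i \<longrightarrow> weval A y (rhs_of C (i, j)) = \<one>\<^bsub>A\<^esub>) \<and>
    (\<forall>i\<in>{1..5}. y i [^]\<^bsub>A\<^esub> p = weval A y (rhs_of P i))"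

lemma rhs_of_words:
  assumes "snd ` set L \<subseteq> words X"
  shows "rhs_of L x \<in> words X"
proof (cases "map_of L x")
  case (Some u)
  then have "u \<in> snd ` set L" using map_of_SomeD by force
  then show ?thesis using assms Some by (auto simp: rhs_of_def)
qed (simp add: rhs_of_def)

lemma gpow_words [simp]: "i \<in> X \<Longrightarrow> gpow i n \<in> words X"
  by (auto simp: gpow_def words_def in_lists_conv_set)

lemma gcomm_words [simp]: "i \<in> X \<Longrightarrow> j \<in> X \<Longrightarrow> gcomm i j \<in> words X"
  by (simp add: gcomm_def)

lemma (in group) weval_gpow:
  assumes "y i \<in> carrier G"
  shows "weval G y (gpow i n) = y i [^] n"
proof -
  have pos: "weval G y (replicate k (i, True)) = y i [^] k" for k
    using assms by (induction k) (simp_all, metis nat_pow_Suc nat_pow_Suc2 inv_closed)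
  have neg: "weval G y (replicate k (i, False)) = inv (y i) [^] k" for k
    using assms by (induction k) (simp_all, metis nat_pow_Suc nat_pow_Suc2 inv_closed)
  show ?thesis
  proof (cases "n < 0")
    case True
    then have "gpow i n = replicate (nat (- n)) (i, False)" by (simp add: gpow_def)
    then have "weval G y (gpow i n) = inv (y i) [^] nat (- n)" by (simp only: neg)
    then show ?thesis using True nat_pow_inv[OF assms] by (simp only: int_pow_def2 if_True)
  next
    case False
    then have "gpow i n = replicate (nat n) (i, True)" by (simp add: gpow_def)
    then have "weval G y (gpow i n) = y i [^] nat n" by (simp only: pos)
    then show ?thesis using False by (simp only: int_pow_def2 if_False)
  qed
qed

lemma (in comm_group) weval_gcomm:
  assumes "y i \<in> carrier G" "y j \<in> carrier G"
  shows "weval G y (gcomm i j) = \<one>"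
proof -
  have "weval G y (gcomm i j) = y i \<otimes> (y j \<otimes> (inv y i \<otimes> inv y j))"
    using assms by (simp add: gcomm_def letter_def word_inv_def)
  also have "inv y i \<otimes> inv y j = inv (y j \<otimes> y i)" using assms by (simp add: inv_mult_group)
  also have "y i \<otimes> (y j \<otimes> inv (y j \<otimes> y i)) = y i \<otimes> y j \<otimes> inv (y j \<otimes> y i)"
    using assms by (simp add: m_assoc)
  also have "y i \<otimes> y j = y j \<otimes> y i" using assms by (rule m_comm)
  finally show ?thesis using assms by simp
qed

text \<open>The premise on \<open>A\<close> expresses, without forming the abelianisation, that the classes of the
  generators with index \<open>s i\<close> generate it and have order dividing \<open>n i\<close>; the maps \<open>v i\<close> are the
  dual coordinates.\<close>

theorem nabla_pc_group:
  fixes G :: "('g, 'm) monoid_scheme" and d p :: nat and n s :: "nat \<Rightarrow> nat"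
    and v :: "nat \<Rightarrow> nat \<Rightarrow> int"
  assumes "group G" and odd: "odd (order G)" and iso: "G \<cong> pc_group p C P"
    and C: "snd ` set C \<subseteq> words {1..5}" and P: "snd ` set P \<subseteq> words {1..5}"
    and s: "s ` {..<d} \<subseteq> {1..5}"
    and n: "\<And>i. i < d \<Longrightarrow> odd (n i)"
    and ab: "\<And>(A :: ('g \<times> 'g) word set monoid) y. comm_group A \<Longrightarrow> ab_rels A p C P y \<Longrightarrow>
      (\<forall>i<d. y (s i) [^]\<^bsub>A\<^esub> n i = \<one>\<^bsub>A\<^esub>) \<and> (\<forall>j\<in>{1..5}. y j \<in> generate A (y ` s ` {..<d}))"
    and v: "\<And>i. i < d \<Longrightarrow> ab_rels (integer_mod_group (n i)) p C P (v i)"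
    and dual: "\<And>i j. i < d \<Longrightarrow> j < d \<Longrightarrow> [v i (s j) = (if i = j then 1 else 0)] (mod int (n i))"
  shows "nabla G \<cong> sum_group {(i, j). i \<le> j \<and> j < d}
    (\<lambda>ij. integer_mod_group (gcd (n (fst ij)) (n (snd ij))))"
proof -
  interpret group G by fact
  let ?X = "{1..5} :: nat set"
  define R where "R = {(gcomm i j, rhs_of C (i, j)) |i j. i \<in> ?X \<and> j \<in> ?X \<and> i > j} \<union>
     {(gpow i (int p), rhs_of P i) |i. i \<in> ?X}"
  let ?H = "presented_group ?X R"
  have H: "pc_group p C P = ?H" by (simp add: pc_group_def R_def)
  note rhs [simp] = rhs_of_words[OF C] rhs_of_words[OF P]
  have "?H \<cong> G" using iso H by (simp add: iso_sym)
  then obtain f where f: "f \<in> hom ?H G" and bij: "bij_betw f (carrier ?H) (carrier G)"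
    by (auto simp: is_iso_def iso_def)
  let ?c = "\<lambda>i. word_class ?X R (letter i)"
  define g where "g = f \<circ> ?c"
  have c: "?c \<in> ?X \<rightarrow> carrier ?H" by simp
  then have gX: "g ` ?X \<subseteq> carrier G"
    using f by (auto simp: g_def hom_def)
  have eval: "f (word_class ?X R u) = weval G g u" if "u \<in> words ?X" for u
    using weval_hom[OF group_presented_group is_group f c that] weval_presented_group[OF that]
    by (simp add: g_def)
  have gen: "generate G (g ` ?X) = carrier G"
  proof
    show "carrier G \<subseteq> generate G (g ` ?X)"
    proof
      fix x assume "x \<in> carrier G"
      then obtain u where "u \<in> words ?X" "x = f (word_class ?X R u)"
        using bij by (auto simp: bij_betw_def carrier_presented_group)
      then show "x \<in> generate G (g ` ?X)" using eval weval_in_generate by metis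
    qed
  qed (rule generate_incl[OF gX])
  have rel: "weval G g u = weval G g u'"
    if "(u, u') \<in> R" "u \<in> words ?X" "u' \<in> words ?X" for u u'
    using that eval[of u] eval[of u'] by (metis word_class_eq_iff word_cong.rel)
  \<comment> \<open>Homomorphisms to abelian groups give solutions of the abelianised relations. The
    converse direction is taken next, for the coordinates \<open>v i\<close>.\<close>
  have ab_hom: "ab_rels A p C P (\<psi> \<circ> g)" if A: "comm_group A" and \<psi>: "\<psi> \<in> hom G A" for \<psi> A
  proof -
    interpret A: comm_group A by fact
    have gf: "g \<in> ?X \<rightarrow> carrier G" using gX by auto
    have yc: "(\<psi> \<circ> g) i \<in> carrier A" if "i \<in> ?X" for i
      using hom_in_carrier[OF \<psi> Pi_mem[OF gf that]] by simp
    have rel': "weval A (\<psi> \<circ> g) u = weval A (\<psi> \<circ> g) u'"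
      if "(u, u') \<in> R" "u \<in> words ?X" "u' \<in> words ?X" for u u'
      using weval_hom[OF is_group A.is_group \<psi> gf] rel[OF that] that by metis
    have "weval A (\<psi> \<circ> g) (rhs_of C (i, j)) = \<one>\<^bsub>A\<^esub>" if "i \<in> ?X" "j \<in> ?X" "j < i" for i j
    proof -
      have "(gcomm i j, rhs_of C (i, j)) \<in> R" unfolding R_def using that by blast
      from rel'[OF this gcomm_words[OF that(1,2)] rhs(1)] show ?thesis
        using A.weval_gcomm[where y = "\<psi> \<circ> g", OF yc[OF that(1)] yc[OF that(2)]] by (simp only:)
    qed
    moreover have "(\<psi> \<circ> g) i [^]\<^bsub>A\<^esub> p = weval A (\<psi> \<circ> g) (rhs_of P i)" if "i \<in> ?X" for i
    proof -
      have "(gpow i (int p), rhs_of P i) \<in> R" unfolding R_def using that by blast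
      from rel'[OF this gpow_words[OF that] rhs(2)] show ?thesis
        using A.weval_gpow[where y = "\<psi> \<circ> g" and n = "int p", OF yc[OF that]] by (simp only: int_pow_int)
    qed
    ultimately show ?thesis using yc unfolding ab_rels_def by blast
  qed
  \<comment> \<open>The values \<open>v i\<close> satisfy the abelianised relations and commutators
    vanish in the target, so von Dyck's theorem gives a character of the presented group; composing
    with the inverse of \<open>f\<close> carries it to \<open>G\<close>.\<close>
  have "\<exists>\<chi>. \<chi> \<in> hom G (integer_mod_group (n i)) \<and> (\<forall>j\<in>?X. \<chi> (g j) = v i j)" if i: "i < d" for i
  proof -
    let ?Z = "integer_mod_group (n i)"
    interpret Z: comm_group ?Z by simp
    have vc: "v i \<in> ?X \<rightarrow> carrier ?Z" using v[OF i] by (simp add: ab_rels_def)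
    have "weval ?Z (v i) u = weval ?Z (v i) u'" if "(u, u') \<in> R" for u u'
    proof -
      consider j k where "j \<in> ?X" "k \<in> ?X" "k < j" "u = gcomm j k" "u' = rhs_of C (j, k)"
        | j where "j \<in> ?X" "u = gpow j (int p)" "u' = rhs_of P j"
        using \<open>(u, u') \<in> R\<close> by (auto simp: R_def)
      then show ?thesis
      proof cases
        case 1
        then have "v i j \<in> carrier ?Z" "v i k \<in> carrier ?Z" using Pi_mem[OF vc] by simp_all
        then show ?thesis using 1 v[OF i] Z.weval_gcomm[where y = "v i" and i = j and j = k] by (simp add: ab_rels_def)
      next
        case 2
        then have "v i j \<in> carrier ?Z" using Pi_mem[OF vc] by simp
        then have "weval ?Z (v i) u = v i j [^]\<^bsub>?Z\<^esub> p"
          using 2 Z.weval_gpow[where y = "v i" and i = j and n = "int p"] by (simp only: int_pow_int)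
        then show ?thesis using 2 v[OF i] unfolding ab_rels_def by metis
      qed
    qed
    from presented_group_hom[OF Z.is_group vc this] obtain \<phi> where
      \<phi>: "\<phi> \<in> hom ?H ?Z" "\<And>u. u \<in> words ?X \<Longrightarrow> \<phi> (word_class ?X R u) = weval ?Z (v i) u"
      by blast
    let ?f' = "inv_into (carrier ?H) f"
    have "?f' \<in> iso G ?H"
      using group.iso_set_sym[OF group_presented_group isoI[OF f bij]] .
    then have "?f' \<in> hom G ?H" by (simp add: iso_def)
    from Group.hom_compose[OF this \<phi>(1)] have "\<phi> \<circ> ?f' \<in> hom G ?Z" .
    moreover have "(\<phi> \<circ> ?f') (g j) = v i j" if "j \<in> ?X" for j
    proof -
      have "?f' (g j) = ?c j"
        using bij that by (simp add: g_def bij_betw_def)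
      moreover have "v i j \<in> carrier ?Z" using Pi_mem[OF vc that] .
      ultimately show ?thesis using \<phi>(2)[of "letter j"] that Z.r_one by (simp add: letter_def)
    qed
    ultimately show ?thesis by blast
  qed
  then obtain \<chi> where \<chi>: "\<And>i. i < d \<Longrightarrow> \<chi> i \<in> hom G (integer_mod_group (n i))"
    "\<And>i j. i < d \<Longrightarrow> j \<in> ?X \<Longrightarrow> \<chi> i (g j) = v i j" by metis
  show ?thesis
  proof (rule nabla_iso_sum_group[OF odd gX gen, where x = "g \<circ> s" and \<chi> = \<chi>])
    show "(g \<circ> s) ` {..<d} \<subseteq> carrier G" using s gX by auto
    \<comment> \<open>The hypothesis \<open>ab\<close> is used at \<open>A = nabla G\<close>; this
      explains the type at which it is stated.\<close>
    show "\<psi> (g j) \<in> generate (nabla G) (\<psi> ` (g \<circ> s) ` {..<d})"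
      if "\<psi> \<in> hom G (nabla G)" "j \<in> ?X" for \<psi> j
      using ab[OF comm_group_nabla ab_hom[OF comm_group_nabla that(1)]] that(2)
      by (simp add: image_image)
    show "\<psi> ((g \<circ> s) i) [^]\<^bsub>nabla G\<^esub> n i = \<one>\<^bsub>nabla G\<^esub>"
      if "\<psi> \<in> hom G (nabla G)" "i < d" for \<psi> i
      using ab[OF comm_group_nabla ab_hom[OF comm_group_nabla that(1)]] that(2) by simp
    show "[\<chi> i ((g \<circ> s) j) = (if i = j then 1 else 0)] (mod int (n i))" if "i < d" "j < d" for i j
      using dual[OF that] \<chi>(2)[OF that(1), of "s j"] s that(2) by auto
  qed (use n \<chi> in auto)
qed

section \<open>Abelianisations with at most one cyclic factor of order larger than p\<close>

lemma card_ordered_pairs: "card {(i, j). i \<le> j \<and> j < (d :: nat)} = (\<Sum>j<d. Suc j)"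
proof -
  have "{(i, j). i \<le> j \<and> j < d} = prod.swap ` (SIGMA j:{..<d}. {..j})" by force
  then show ?thesis by (simp add: card_image inj_on_def)
qed

lemma finite_ordered_pairs: "finite {(i, j). i \<le> j \<and> j < (d :: nat)}"
  by (rule finite_subset[of _ "{..<d} \<times> {..<d}"]) auto

text \<open>Only the pair \<open>(0, 0)\<close> contributes a summand of order \<open>n 0\<close>.
  Any other ordered pair has a positive second index, where \<open>n\<close> is \<open>p\<close>,
  and \<open>p\<close> divides \<open>n 0\<close>, so its gcd is \<open>p\<close>.\<close>

lemma sum_group_gcd_iso_DirProd:
  fixes n :: "nat \<Rightarrow> nat"
  assumes "0 < d" "p dvd n 0" "\<And>i. 0 < i \<Longrightarrow> i < d \<Longrightarrow> n i = p" "(\<Sum>j<d. Suc j) = Suc r"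
  shows "sum_group {(i, j). i \<le> j \<and> j < d}
    (\<lambda>ij. integer_mod_group (gcd (n (fst ij)) (n (snd ij)))) \<cong>
    integer_mod_group (n 0) \<times>\<times> cyc_sum p r"
proof -
  let ?I = "{(i, j). i \<le> j \<and> j < d}" and ?F = "\<lambda>ij. gcd (n (fst ij)) (n (snd ij))"
  have I: "insert (0, 0) (?I - {(0, 0)}) = ?I" using assms(1) by auto
  have fin: "finite (?I - {(0, 0)})" using finite_ordered_pairs by simp
  have "sum_group (insert (0, 0) (?I - {(0, 0)})) (\<lambda>ij. integer_mod_group (?F ij)) \<cong>
      integer_mod_group (?F (0, 0)) \<times>\<times> sum_group (?I - {(0, 0)}) (\<lambda>ij. integer_mod_group (?F ij))"
    using fin by (intro sum_group_insert_iso) auto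
  moreover have "sum_group (?I - {(0, 0)}) (\<lambda>ij. integer_mod_group (?F ij)) \<cong> cyc_sum p r"
  proof (rule sum_group_iso_cyc_sum[OF fin])
    show "card (?I - {(0, 0)}) = r"
      using assms(1,4) card_ordered_pairs[of d] finite_ordered_pairs[of d] by simp
    show "?F ij = p" if "ij \<in> ?I - {(0, 0)}" for ij
    proof -
      obtain i j where ij: "ij = (i, j)" "i \<le> j" "j < d" "0 < j" using \<open>ij \<in> _\<close> by auto
      then show ?thesis using assms(2,3) by (cases "i = 0") auto
    qed
  qed
  then have "integer_mod_group (?F (0, 0)) \<times>\<times> sum_group (?I - {(0, 0)}) (\<lambda>ij. integer_mod_group (?F ij)) \<cong>
      integer_mod_group (?F (0, 0)) \<times>\<times> cyc_sum p r" by (rule DirProd_iso_cong_right)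
  ultimately show ?thesis unfolding I using iso_trans by fastforce
qed

lemma weval_trivial:
  assumes "group H" "\<And>x. x \<in> X \<Longrightarrow> f x = \<one>\<^bsub>H\<^esub>" "u \<in> words X"
  shows "weval H f u = \<one>\<^bsub>H\<^esub>"
proof -
  interpret group H by fact
  show ?thesis using assms(2,3) by (induction u) auto
qed

lemma words_mono: "X \<subseteq> Y \<Longrightarrow> words X \<subseteq> words Y"
  by (auto simp: words_def in_lists_conv_set)

text \<open>If all right-hand sides are words in the generators after the \<open>d\<close>-th, and
  these die in every abelian image, then the abelianisation is elementary of rank \<open>d\<close>
  on the first \<open>d\<close> generators. Its coordinates are Kronecker deltas: they vanish on
  every letter of a right-hand side, so the relations hold.\<close>

theorem nabla_pc_group_elementary:
  fixes G :: "('g, 'm) monoid_scheme" and d p :: nat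
  assumes "group G" "odd (order G)" "G \<cong> pc_group p C P" and p: "1 < p" "odd p" and d: "d \<le> 5"
    and C: "snd ` set C \<subseteq> words {d<..5}" and P: "snd ` set P \<subseteq> words {d<..5}"
    and triv: "\<And>(A :: ('g \<times> 'g) word set monoid) y. comm_group A \<Longrightarrow> ab_rels A p C P y \<Longrightarrow>
      \<forall>j\<in>{d<..5}. y j = \<one>\<^bsub>A\<^esub>"
  shows "nabla G \<cong> cyc_sum p (\<Sum>j<d. Suc j)"
proof -
  have sub: "words {d<..5} \<subseteq> words {1..5}" by (rule words_mono) auto
  have "nabla G \<cong> sum_group {(i, j). i \<le> j \<and> j < d} (\<lambda>ij. integer_mod_group (gcd p p))"
  \<comment> \<open>The generators are numbered from 1 and the coordinates from 0, hence
    \<open>Suc\<close>.\<close>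
  proof (rule nabla_pc_group[OF assms(1-3), where s = Suc and n = "\<lambda>_. p"
        and v = "\<lambda>i j. if j = Suc i then 1 else 0"])
    show "snd ` set C \<subseteq> words {1..5}" "snd ` set P \<subseteq> words {1..5}" using C P sub by auto
    show "Suc ` {..<d} \<subseteq> {1..5}" using d by auto
    show "(\<forall>i<d. y (Suc i) [^]\<^bsub>A\<^esub> p = \<one>\<^bsub>A\<^esub>) \<and> (\<forall>j\<in>{1..5}. y j \<in> generate A (y ` Suc ` {..<d}))"
      if A: "comm_group A" and y: "ab_rels A p C P y" for A :: "('g \<times> 'g) word set monoid" and y
    proof (intro conjI allI impI ballI)
      interpret A: comm_group A by fact
      have one: "y j = \<one>\<^bsub>A\<^esub>" if "j \<in> {d<..5}" for j using triv[OF A y] that by blast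
      show "y (Suc i) [^]\<^bsub>A\<^esub> p = \<one>\<^bsub>A\<^esub>" if "i < d" for i
        using y d that weval_trivial[OF A.is_group one rhs_of_words[OF P]] by (simp add: ab_rels_def)
      show "y j \<in> generate A (y ` Suc ` {..<d})" if j: "j \<in> {1..5}" for j
      proof (cases "j \<le> d")
        case True
        then obtain i where "j = Suc i" "i < d" using j by (cases j) auto
        then show ?thesis by (intro generate.incl) auto
      next
        case False
        then show ?thesis using one j by (auto intro: generate.one)
      qed
    qed
    show "ab_rels (integer_mod_group p) p C P (\<lambda>j. if j = Suc i then 1 else 0)" if i: "i < d" for i
    proof -
      have "weval (integer_mod_group p) (\<lambda>j. if j = Suc i then 1 else 0) u = 0"
        if "u \<in> words {d<..5}" for u
        using weval_trivial[OF group_integer_mod_group _ that, where f = "\<lambda>j. if j = Suc i then 1 else 0"] i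
        by auto
      then show ?thesis
        using p rhs_of_words[OF C] rhs_of_words[OF P] by (auto simp: ab_rels_def)
    qed
  qed (use p in auto)
  also have "\<dots> \<cong> cyc_sum p (\<Sum>j<d. Suc j)"
    by (rule sum_group_iso_cyc_sum) (simp_all add: finite_ordered_pairs card_ordered_pairs)
  finally show ?thesis .
qed

text \<open>Position 0 carries the factor of order \<open>p ^ e\<close>, the positions after it
  factors of order \<open>p\<close>. The coordinate \<open>v\<close> of position 0 is kept general:
  when powers of its generator are generators themselves, \<open>v\<close> must take the matching
  nonzero values there. The other coordinates are Kronecker deltas.\<close>

theorem nabla_pc_group_mixed:
  fixes G :: "('g, 'm) monoid_scheme" and d p e r :: nat and s :: "nat \<Rightarrow> nat"
  assumes "group G" "odd (order G)" "G \<cong> pc_group p C P" and p: "1 < p" "odd p"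
    and C: "snd ` set C \<subseteq> words {1..5}" and P: "snd ` set P \<subseteq> words {1..5}"
    and s: "s ` {..<d} \<subseteq> {1..5}" "inj_on s {..<d}" and d: "0 < d" and e: "0 < e"
    and ab: "\<And>(A :: ('g \<times> 'g) word set monoid) y. comm_group A \<Longrightarrow> ab_rels A p C P y \<Longrightarrow>
      y (s 0) [^]\<^bsub>A\<^esub> (p ^ e) = \<one>\<^bsub>A\<^esub> \<and> (\<forall>i\<in>{0<..<d}. y (s i) [^]\<^bsub>A\<^esub> p = \<one>\<^bsub>A\<^esub>) \<and>
      (\<forall>j\<in>{1..5}. y j \<in> generate A (y ` s ` {..<d}))"
    and v: "ab_rels (integer_mod_group (p ^ e)) p C P v" "v (s 0) = 1"
      "\<And>i. i \<in> {0<..<d} \<Longrightarrow> v (s i) = 0"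
    and ind: "\<And>i. i \<in> {0<..<d} \<Longrightarrow>
      ab_rels (integer_mod_group p) p C P (\<lambda>j. if j = s i then 1 else 0)"
    and r: "(\<Sum>j<d. Suc j) = Suc r"
  shows "nabla G \<cong> integer_mod_group (p ^ e) \<times>\<times> cyc_sum p r"
proof -
  let ?n = "\<lambda>i::nat. if i = 0 then p ^ e else p"
  have "nabla G \<cong> sum_group {(i, j). i \<le> j \<and> j < d}
      (\<lambda>ij. integer_mod_group (gcd (?n (fst ij)) (?n (snd ij))))"
  proof (rule nabla_pc_group[OF assms(1-3) C P s(1),
        where v = "\<lambda>i. if i = 0 then v else (\<lambda>j. if j = s i then 1 else 0)"])
    show "(\<forall>i<d. y (s i) [^]\<^bsub>A\<^esub> ?n i = \<one>\<^bsub>A\<^esub>) \<and> (\<forall>j\<in>{1..5}. y j \<in> generate A (y ` s ` {..<d}))"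
      if "comm_group A" and "ab_rels A p C P y" for A :: "('g \<times> 'g) word set monoid" and y
      using ab[OF that] by auto
    show "[(if i = 0 then v else (\<lambda>j. if j = s i then 1 else 0)) (s j) = (if i = j then 1 else 0)]
        (mod int (?n i))" if "i < d" "j < d" for i j
      using v that s(2) by (cases "i = 0"; cases "j = 0") (auto dest: inj_onD)
  qed (use p v ind in auto)
  also have "sum_group {(i, j). i \<le> j \<and> j < d}
      (\<lambda>ij. integer_mod_group (gcd (?n (fst ij)) (?n (snd ij)))) \<cong>
      integer_mod_group (?n 0) \<times>\<times> cyc_sum p r"
    by (rule sum_group_gcd_iso_DirProd[where n = ?n]) (use d e r in auto)
  finally show ?thesis by simp
qed

section \<open>The abelianised relations of the listed groups\<close>

lemma ab_rels_iff:
  "ab_rels A p C P y \<longleftrightarrow>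
    y 1 \<in> carrier A \<and> y 2 \<in> carrier A \<and> y 3 \<in> carrier A \<and> y 4 \<in> carrier A \<and> y 5 \<in> carrier A \<and>
    weval A y (rhs_of C (2, 1)) = \<one>\<^bsub>A\<^esub> \<and>
    weval A y (rhs_of C (3, 1)) = \<one>\<^bsub>A\<^esub> \<and> weval A y (rhs_of C (3, 2)) = \<one>\<^bsub>A\<^esub> \<and>
    weval A y (rhs_of C (4, 1)) = \<one>\<^bsub>A\<^esub> \<and> weval A y (rhs_of C (4, 2)) = \<one>\<^bsub>A\<^esub> \<and>
    weval A y (rhs_of C (4, 3)) = \<one>\<^bsub>A\<^esub> \<and>
    weval A y (rhs_of C (5, 1)) = \<one>\<^bsub>A\<^esub> \<and> weval A y (rhs_of C (5, 2)) = \<one>\<^bsub>A\<^esub> \<and>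
    weval A y (rhs_of C (5, 3)) = \<one>\<^bsub>A\<^esub> \<and> weval A y (rhs_of C (5, 4)) = \<one>\<^bsub>A\<^esub> \<and>
    y 1 [^]\<^bsub>A\<^esub> p = weval A y (rhs_of P 1) \<and> y 2 [^]\<^bsub>A\<^esub> p = weval A y (rhs_of P 2) \<and>
    y 3 [^]\<^bsub>A\<^esub> p = weval A y (rhs_of P 3) \<and> y 4 [^]\<^bsub>A\<^esub> p = weval A y (rhs_of P 4) \<and>
    y 5 [^]\<^bsub>A\<^esub> p = weval A y (rhs_of P 5)"
proof -
  have "{1..5} = {1, 2, 3, 4, 5::nat}" by auto
  then show ?thesis
    by (simp add: ab_rels_def) (intro iffI; elim conjE; intro conjI; assumption)
qed

lemma (in group) weval_gpow_append:
  assumes "y i \<in> carrier G" "y j \<in> carrier G"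
  shows "weval G y (gpow i m @ gpow j n) = y i [^] m \<otimes> y j [^] n"
proof -
  have "y \<in> {i, j} \<rightarrow> carrier G" using assms by auto
  from weval_append[OF this] show ?thesis using assms by (simp add: weval_gpow)
qed

text \<open>By Bezout, \<open>x\<close> is a product of powers of \<open>x [^] c\<close> and of
  \<open>x [^] p\<close>. It removes the exponents \<open>w\<close>, \<open>w ^ k\<close> and
  \<open>w_pow p w a\<close> from the relations.\<close>

lemma (in group) int_pow_eq_one_iff:
  assumes "x \<in> carrier G" "x [^] (p :: nat) = \<one>" "coprime (c :: int) (int p)"
  shows "x [^] c = \<one> \<longleftrightarrow> x = \<one>"
proof
  assume c: "x [^] c = \<one>"
  from assms(3) obtain a b where "a * c + b * int p = 1"
    using bezout_int[of c "int p"] by (auto simp: coprime_iff_gcd_eq_1)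
  then have "x = x [^] (c * a + int p * b)" using assms(1) by (simp add: mult.commute)
  also have "\<dots> = (x [^] c) [^] a \<otimes> (x [^] int p) [^] b"
    using assms(1) by (simp add: int_pow_mult int_pow_pow)
  finally show "x = \<one>" using c assms(2) by (simp add: int_pow_int)
qed simp

text \<open>Elimination of \<open>x\<close> leaves \<open>y\<close> with exponent
  \<open>1 - m * n\<close>, the determinant of the two relations. Rows 12 and 50 lead to such a
  system.\<close>

lemma (in comm_group) int_pow_cross_eq_one:
  assumes x: "x \<in> carrier G" and y: "y \<in> carrier G" and "y [^] (p :: nat) = \<one>"
    and "x \<otimes> y [^] (m :: int) = \<one>" and "x [^] (n :: int) \<otimes> y = \<one>" and "coprime (1 - m * n) (int p)"
  shows "x = \<one>" "y = \<one>"
proof -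
  have "x = y [^] (- m)"
    using inv_equality[OF assms(4)] x y by (simp add: int_pow_neg)
  then have "y [^] (- m * n) \<otimes> y [^] (1::int) = \<one>" using assms(5) y by (simp add: int_pow_pow)
  then have "y [^] (1 - m * n) = \<one>" using int_pow_mult[OF y, of "- m * n" 1] by simp
  then show "y = \<one>" using int_pow_eq_one_iff[OF y assms(3,6)] by simp
  then show "x = \<one>" using assms(4) x by simp
qed

lemma coprime_primroot_cross:
  assumes "prime p" "p > 2" "residue_primroot p (nat (w mod int p))" "1 \<le> k"
  shows "coprime (1 - w ^ k * w ^ (k - 1)) (int p)"
proof -
  have p: "prime (int p)" using assms(1) by simp
  have "\<not> int p dvd 1 - w ^ k * w ^ (k - 1)"
  proof
    assume "int p dvd 1 - w ^ k * w ^ (k - 1)"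
    \<comment> \<open>The bound \<open>1 \<le> k\<close> makes the subtraction of natural numbers a
      true one, so the exponent \<open>2 * k - 1\<close> is odd.\<close>
    moreover have "w ^ k * w ^ (k - 1) = w ^ (2 * k - 1)"
      using assms(4) by (simp flip: power_add add: mult_2)
    ultimately have "[w ^ (2 * k - 1) = 1] (mod int p)"
      by (simp add: cong_iff_dvd_diff dvd_diff_commute)
    \<comment> \<open>The primitive root is given as the natural number that represents
      \<open>w\<close>, so the congruence is moved there. Its order \<open>p - 1\<close> is even and
      cannot divide an odd exponent.\<close>
    then have "[(w mod int p) ^ (2 * k - 1) = 1] (mod int p)"
      by (simp add: cong_def power_mod)
    moreover have "int (nat (w mod int p)) = w mod int p"
      using assms(2) by simp
    ultimately have "[int (nat (w mod int p) ^ (2 * k - 1)) = int 1] (mod int p)" by simp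
    then have "[nat (w mod int p) ^ (2 * k - 1) = 1] (mod p)" by (simp only: cong_int_iff)
    then have "ord p (nat (w mod int p)) dvd 2 * k - 1" by (simp only: ord_divides)
    moreover have "ord p (nat (w mod int p)) = p - 1"
      using assms by (simp add: residue_primroot_def totient_prime)
    moreover have "even (p - 1)" using assms(1,2) prime_odd_nat by auto
    moreover have "odd (2 * k - 1)" using assms(4) by simp
    ultimately show False by (metis dvd_trans)
  qed
  then show ?thesis using p prime_imp_coprime coprime_commute by blast
qed

lemma coprime_primroot:
  assumes "prime p" "residue_primroot p (nat (w mod int p))"
  shows "coprime w (int p)"
proof -
  have "coprime p (nat (w mod int p))" using assms(2) by (simp add: residue_primroot_def)
  moreover have "int (nat (w mod int p)) = w mod int p"
    using assms(1) prime_gt_0_nat by simp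
  ultimately have "coprime (int p) (w mod int p)" by (metis coprime_int_iff)
  then show ?thesis
    using assms(1) prime_gt_0_nat by (simp add: coprime_commute)
qed

lemma coprime_w_pow:
  assumes "coprime w (int p)"
  shows "coprime (w_pow p w a) (int p)"
proof (cases "0 \<le> a")
  case False
  then show ?thesis using assms by (simp add: w_pow_def)
qed (use assms in \<open>simp add: w_pow_def\<close>)

text \<open>The facts about the table are proved for any row that belongs to the list. Knowing that
  \<open>map_of\<close> returns some row with index \<open>i\<close> is then enough, and the lookup
  itself need not be evaluated.\<close>

lemma G_grp_row:
  assumes "i \<in> fst ` set (G_table p w a b k)"
  obtains C P where "(i, C, P) \<in> set (G_table p w a b k)" "G_grp p w a b k i = pc_group p C P"
proof -
  obtain CP where "map_of (G_table p w a b k) i = Some CP"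
    using assms by (metis map_of_eq_None_iff not_None_eq)
  then show thesis using that map_of_SomeD by (cases CP) (fastforce simp: G_grp_def)
qed

text \<open>Most of these generators are themselves right-hand sides of commutator relations. In the
  remaining cases the relations are powers with exponent prime to \<open>p\<close>, or form a
  triangular or a two by two system in \<open>y 4\<close> and \<open>y 5\<close>.\<close>

lemma rows_trivial:
  assumes "comm_group A" and "coprime w (int p)" and "coprime (1 - w ^ k * w ^ (k - 1)) (int p)"
    and row: "(i, C, P) \<in> set (G_table p w a b k)" and y: "ab_rels A p C P y"
  shows "i \<in> {3..10} \<union> {11, 12, 28, 29, 30, 31, 32, 33} \<Longrightarrow>
      y 3 = \<one>\<^bsub>A\<^esub> \<and> y 4 = \<one>\<^bsub>A\<^esub> \<and> y 5 = \<one>\<^bsub>A\<^esub>"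
    and "i \<in> {34, 36, 38, 39, 41, 42, 44, 46, 48, 49, 50} \<union> {54..63} \<Longrightarrow>
      y 4 = \<one>\<^bsub>A\<^esub> \<and> y 5 = \<one>\<^bsub>A\<^esub>"
    and "i \<in> {64, 65, 67, 68, 69} \<Longrightarrow> y 5 = \<one>\<^bsub>A\<^esub>"
proof -
  interpret A: comm_group A by fact
  have c: "y (Suc 0) \<in> carrier A" "y 2 \<in> carrier A" "y 3 \<in> carrier A" "y 4 \<in> carrier A" "y 5 \<in> carrier A"
    using y by (simp_all add: ab_rels_iff)
  note weval = c A.weval_gpow A.weval_gpow_append
  note cases = row[unfolded G_table_def list.set insert_iff empty_iff prod.inject]
  note num_cases = numeral_eq_iff num.distinct num.inject simp_thms if_False if_True numeral_le_iff le_num_simps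
  \<comment> \<open>No row lists a \<open>p\<close>-th power of the fifth generator.\<close>
  have y5p: "y 5 [^]\<^bsub>A\<^esub> p = \<one>\<^bsub>A\<^esub>"
    using cases y
    by (elim disjE conjE FalseE; hypsubst) (simp_all add: ab_rels_iff rhs_of_def)
  have pow5: "y 5 [^]\<^bsub>A\<^esub> w = \<one>\<^bsub>A\<^esub> \<longleftrightarrow> y 5 = \<one>\<^bsub>A\<^esub>"
    "y 5 [^]\<^bsub>A\<^esub> (w ^ k) = \<one>\<^bsub>A\<^esub> \<longleftrightarrow> y 5 = \<one>\<^bsub>A\<^esub>"
    "y 5 [^]\<^bsub>A\<^esub> w_pow p w c = \<one>\<^bsub>A\<^esub> \<longleftrightarrow> y 5 = \<one>\<^bsub>A\<^esub>" for c
    by (rule A.int_pow_eq_one_iff[OF c(5) y5p]; use assms(2) coprime_w_pow in simp)+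
  \<comment> \<open>Rows 8, 9 and 46: a second commutator relation gives \<open>y 5\<close>
    directly.\<close>
  have triangular: "y 4 \<otimes>\<^bsub>A\<^esub> y 5 = \<one>\<^bsub>A\<^esub> \<Longrightarrow> y 5 = \<one>\<^bsub>A\<^esub> \<Longrightarrow> y 4 = \<one>\<^bsub>A\<^esub>"
    "y 4 \<otimes>\<^bsub>A\<^esub> y 5 [^]\<^bsub>A\<^esub> w = \<one>\<^bsub>A\<^esub> \<Longrightarrow> y 5 = \<one>\<^bsub>A\<^esub> \<Longrightarrow> y 4 = \<one>\<^bsub>A\<^esub>"
    using c by simp_all
  \<comment> \<open>Rows 12 and 50: neither relation can be used alone, and
    \<open>int_pow_cross_eq_one\<close> solves both together.\<close>
  have cross: "y 4 = \<one>\<^bsub>A\<^esub> \<and> y 5 = \<one>\<^bsub>A\<^esub>"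
    if "y 4 \<otimes>\<^bsub>A\<^esub> y 5 [^]\<^bsub>A\<^esub> (w ^ k) = \<one>\<^bsub>A\<^esub>" "y 4 [^]\<^bsub>A\<^esub> (w ^ (k - Suc 0)) \<otimes>\<^bsub>A\<^esub> y 5 = \<one>\<^bsub>A\<^esub>"
    using A.int_pow_cross_eq_one[OF c(4,5) y5p _ _ assms(3)] that by simp_all
  show "y 3 = \<one>\<^bsub>A\<^esub> \<and> y 4 = \<one>\<^bsub>A\<^esub> \<and> y 5 = \<one>\<^bsub>A\<^esub>" if "i \<in> {3..10} \<union> {11, 12, 28, 29, 30, 31, 32, 33}"
    using cases that y
    apply (elim disjE conjE FalseE; hypsubst)
    apply (simp_all only: Un_iff insert_iff empty_iff atLeastAtMost_iff num_cases)
    apply (simp_all add: ab_rels_iff rhs_of_def weval)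
    apply (simp_all add: pow5)
    apply (elim conjE; erule (1) triangular cross)+
    done
  show "y 4 = \<one>\<^bsub>A\<^esub> \<and> y 5 = \<one>\<^bsub>A\<^esub>" if "i \<in> {34, 36, 38, 39, 41, 42, 44, 46, 48, 49, 50} \<union> {54..63}"
    using cases that y
    apply (elim disjE conjE FalseE; hypsubst)
    apply (simp_all only: Un_iff insert_iff empty_iff atLeastAtMost_iff num_cases)
    apply (simp_all add: ab_rels_iff rhs_of_def weval)
    apply (simp_all add: pow5)
    apply (elim conjE; erule (1) triangular cross)+
    done
  show "y 5 = \<one>\<^bsub>A\<^esub>" if "i \<in> {64, 65, 67, 68, 69}"
    using cases that y
    apply (elim disjE conjE FalseE; hypsubst)
    apply (simp_all only: Un_iff insert_iff empty_iff atLeastAtMost_iff num_cases)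
    apply (simp_all add: ab_rels_iff rhs_of_def weval)
    done
qed

text \<open>The bounds 2, 3 and 4 are the ranks at which \<open>nabla_pc_group_elementary\<close>
  will be applied: only the generators after them occur on right-hand sides.\<close>

lemma G_table_words:
  assumes row: "(i, C, P) \<in> set (G_table p w a b k)"
  shows "snd ` set C \<subseteq> words {1..5} \<and> snd ` set P \<subseteq> words {1..5}"
    and "i \<in> {3..10} \<union> {11, 12, 28, 29, 30, 31, 32, 33} \<Longrightarrow>
      snd ` set C \<subseteq> words {2<..5} \<and> snd ` set P \<subseteq> words {2<..5}"
    and "i \<in> {34, 36, 38, 39, 41, 42, 44, 46, 48, 49, 50} \<union> {54..63} \<Longrightarrow>
      snd ` set C \<subseteq> words {3<..5} \<and> snd ` set P \<subseteq> words {3<..5}"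
    and "i \<in> {64, 65, 67, 68, 69} \<Longrightarrow>
      snd ` set C \<subseteq> words {4<..5} \<and> snd ` set P \<subseteq> words {4<..5}"
proof -
  note cases = row[unfolded G_table_def list.set insert_iff empty_iff prod.inject]
  note num_cases = numeral_eq_iff num.distinct num.inject simp_thms if_False if_True numeral_le_iff le_num_simps
  show "snd ` set C \<subseteq> words {1..5} \<and> snd ` set P \<subseteq> words {1..5}"
    using cases by (elim disjE conjE FalseE; hypsubst) simp_all
  show "snd ` set C \<subseteq> words {2<..5} \<and> snd ` set P \<subseteq> words {2<..5}"
    if "i \<in> {3..10} \<union> {11, 12, 28, 29, 30, 31, 32, 33}"
    using cases that
    by (elim disjE conjE FalseE; hypsubst)
      (simp_all only: Un_iff insert_iff empty_iff atLeastAtMost_iff num_cases, simp_all)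
  show "snd ` set C \<subseteq> words {3<..5} \<and> snd ` set P \<subseteq> words {3<..5}"
    if "i \<in> {34, 36, 38, 39, 41, 42, 44, 46, 48, 49, 50} \<union> {54..63}"
    using cases that
    by (elim disjE conjE FalseE; hypsubst)
      (simp_all only: Un_iff insert_iff empty_iff atLeastAtMost_iff num_cases, simp_all)
  show "snd ` set C \<subseteq> words {4<..5} \<and> snd ` set P \<subseteq> words {4<..5}"
    if "i \<in> {64, 65, 67, 68, 69}"
    using cases that
    by (elim disjE conjE FalseE; hypsubst)
      (simp_all only: Un_iff insert_iff empty_iff atLeastAtMost_iff num_cases, simp_all)
qed

text \<open>The abelianisations have ranks 2, 3 and 4, with 3, 6 and 10 ordered pairs of
  positions.\<close>

lemma nabla_G_elementary:
  fixes G :: "('g, 'm) monoid_scheme" and p k :: nat and w a b :: int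
  assumes p: "prime p" "p > 3" and w: "residue_primroot p (nat (w mod int p))" and k: "1 \<le> k"
    and G: "group G" "odd (order G)" and iso: "G \<cong> G_grp p w a b k i"
  shows "i \<in> {3..10} \<union> {11, 12, 28, 29, 30, 31, 32, 33} \<Longrightarrow> nabla G \<cong> cyc_sum p 3"
    and "i \<in> {34, 36, 38, 39, 41, 42, 44, 46, 48, 49, 50} \<union> {54..63} \<Longrightarrow> nabla G \<cong> cyc_sum p 6"
    and "i \<in> {64, 65, 67, 68, 69} \<Longrightarrow> nabla G \<cong> cyc_sum p 10"
proof -
  have p1: "1 < p" and odd: "odd p" using p prime_odd_nat by auto
  have c: "coprime w (int p)" "coprime (1 - w ^ k * w ^ (k - 1)) (int p)"
    using coprime_primroot[OF p(1) w] coprime_primroot_cross[OF p(1) _ w k] p(2) by auto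
  have ivl: "{2<..5} = {3, 4, 5::nat}" "{3<..5} = {4, 5::nat}" "{4<..5} = {5::nat}" by auto
  have main: "nabla G \<cong> cyc_sum p (\<Sum>j<d. Suc j)"
    if i: "i \<in> fst ` set (G_table p w a b k)" and d: "d \<le> 5"
      and wd: "\<And>C P. (i, C, P) \<in> set (G_table p w a b k) \<Longrightarrow>
        snd ` set C \<subseteq> words {d<..5} \<and> snd ` set P \<subseteq> words {d<..5}"
      and triv: "\<And>C P (A :: ('g \<times> 'g) word set monoid) y. (i, C, P) \<in> set (G_table p w a b k) \<Longrightarrow>
        comm_group A \<Longrightarrow> ab_rels A p C P y \<Longrightarrow> \<forall>j\<in>{d<..5}. y j = \<one>\<^bsub>A\<^esub>" for d
  proof -
    obtain C P where row: "(i, C, P) \<in> set (G_table p w a b k)" "G_grp p w a b k i = pc_group p C P"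
      using G_grp_row[OF i] .
    show ?thesis
      using wd[OF row(1)] iso row(2)
      by (intro nabla_pc_group_elementary[OF G _ p1 odd d _ _ triv[OF row(1)]]) auto
  qed
  show "nabla G \<cong> cyc_sum p 3" if i: "i \<in> {3..10} \<union> {11, 12, 28, 29, 30, 31, 32, 33}"
  proof -
    have "i \<in> fst ` set (G_table p w a b k)" using i by (auto simp: G_table_def)
    then have "nabla G \<cong> cyc_sum p (\<Sum>j<2. Suc j)"
    proof (rule main)
      fix C P and A :: "('g \<times> 'g) word set monoid" and y
      assume row: "(i, C, P) \<in> set (G_table p w a b k)"
      then show "snd ` set C \<subseteq> words {2<..5} \<and> snd ` set P \<subseteq> words {2<..5}"
        using G_table_words(2) i by blast
      assume "comm_group A" "ab_rels A p C P y"
      then show "\<forall>j\<in>{2<..5}. y j = \<one>\<^bsub>A\<^esub>"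
        using rows_trivial(1)[OF _ c row _ i] unfolding ivl by simp
    qed simp
    then show ?thesis by (simp add: numeral_eq_Suc)
  qed
  show "nabla G \<cong> cyc_sum p 6"
    if i: "i \<in> {34, 36, 38, 39, 41, 42, 44, 46, 48, 49, 50} \<union> {54..63}"
  proof -
    have "{54..63} = {54, 55, 56, 57, 58, 59, 60, 61, 62, 63::nat}"
      unfolding set_eq_iff insert_iff empty_iff atLeastAtMost_iff by presburger
    with i have "i \<in> fst ` set (G_table p w a b k)" by (auto simp: G_table_def)
    then have "nabla G \<cong> cyc_sum p (\<Sum>j<3. Suc j)"
    proof (rule main)
      fix C P and A :: "('g \<times> 'g) word set monoid" and y
      assume row: "(i, C, P) \<in> set (G_table p w a b k)"
      then show "snd ` set C \<subseteq> words {3<..5} \<and> snd ` set P \<subseteq> words {3<..5}"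
        using G_table_words(3) i by blast
      assume "comm_group A" "ab_rels A p C P y"
      then show "\<forall>j\<in>{3<..5}. y j = \<one>\<^bsub>A\<^esub>"
        using rows_trivial(2)[OF _ c row _ i] unfolding ivl by simp
    qed simp
    then show ?thesis by (simp add: numeral_eq_Suc)
  qed
  show "nabla G \<cong> cyc_sum p 10" if i: "i \<in> {64, 65, 67, 68, 69}"
  proof -
    have "i \<in> fst ` set (G_table p w a b k)" using i by (auto simp: G_table_def)
    then have "nabla G \<cong> cyc_sum p (\<Sum>j<4. Suc j)"
    proof (rule main)
      fix C P and A :: "('g \<times> 'g) word set monoid" and y
      assume row: "(i, C, P) \<in> set (G_table p w a b k)"
      then show "snd ` set C \<subseteq> words {4<..5} \<and> snd ` set P \<subseteq> words {4<..5}"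
        using G_table_words(4) i by blast
      assume "comm_group A" "ab_rels A p C P y"
      then show "\<forall>j\<in>{4<..5}. y j = \<one>\<^bsub>A\<^esub>"
        using rows_trivial(3)[OF _ c row _ i] unfolding ivl by simp
    qed simp
    then show ?thesis by (simp add: numeral_eq_Suc)
  qed
qed

section \<open>Abelianisations of types (p^2, p, p), (p^3, p) and (p^2, p^2)\<close>

theorem nabla_pc_group_p2:
  fixes G :: "('g, 'm) monoid_scheme" and p x x' y z t :: nat
  assumes G: "group G" "odd (order G)" "G \<cong> pc_group p C P" and p: "1 < p" "odd p"
    and CP: "snd ` set C \<subseteq> words {1..5} \<and> snd ` set P \<subseteq> words {1..5}"
    and gens: "{x, x', y, z, t} = {1..5}"
    and ab: "\<And>(A :: ('g \<times> 'g) word set monoid) f. comm_group A \<Longrightarrow> ab_rels A p C P f \<Longrightarrow>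
      f t = \<one>\<^bsub>A\<^esub> \<and> f x [^]\<^bsub>A\<^esub> p = f x' \<and> f x' [^]\<^bsub>A\<^esub> p = \<one>\<^bsub>A\<^esub> \<and>
      f y [^]\<^bsub>A\<^esub> p = \<one>\<^bsub>A\<^esub> \<and> f z [^]\<^bsub>A\<^esub> p = \<one>\<^bsub>A\<^esub>"
    and v: "ab_rels (integer_mod_group (p ^ 2)) p C P
        (\<lambda>j. if j = x then 1 else if j = x' then int p else 0)"
      "ab_rels (integer_mod_group p) p C P (\<lambda>j. if j = y then 1 else 0)"
      "ab_rels (integer_mod_group p) p C P (\<lambda>j. if j = z then 1 else 0)"
  shows "nabla G \<cong> integer_mod_group (p ^ 2) \<times>\<times> cyc_sum p 5"
proof -
  \<comment> \<open>Five names that exhaust a set of five elements are distinct.\<close>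
  have "card {x, x', y, z, t} = 5" by (simp only: gens card_atLeastAtMost)
  then have "card (set [x, x', y, z, t]) = length [x, x', y, z, t]" by simp
  then have dist: "distinct [x, x', y, z, t]" by (rule card_distinct)
  have mem: "x \<in> {1..5}" "x' \<in> {1..5}" "y \<in> {1..5}" "z \<in> {1..5}" using gens by blast+
  \<comment> \<open>The generator \<open>x\<close> has order dividing \<open>p ^ 2\<close> with
    \<open>p\<close>-th power \<open>x'\<close>, both \<open>y\<close> and \<open>z\<close> have
    order dividing \<open>p\<close>, and \<open>t\<close> is trivial in the abelianisation. Thus
    \<open>x\<close> takes position 0, and its coordinate has the value \<open>p\<close> at
    \<open>x'\<close>.\<close>
  let ?s = "\<lambda>i. [x, y, z] ! i"
  have s: "?s ` {..<3} = {x, y, z}" by (force simp: numeral_3_eq_3 lessThan_Suc)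
  have I: "{0<..<3} = {1, 2::nat}" by auto
  show ?thesis
  proof (rule nabla_pc_group_mixed[OF G p, where s = ?s and d = 3 and e = 2
        and v = "\<lambda>j. if j = x then 1 else if j = x' then int p else 0"])
    show "?s ` {..<3} \<subseteq> {1..5}" using mem unfolding s by blast
    show "inj_on ?s {..<3}" using dist by (auto simp: inj_on_def numeral_3_eq_3 less_Suc_eq)
    show "f (?s 0) [^]\<^bsub>A\<^esub> (p ^ 2) = \<one>\<^bsub>A\<^esub> \<and> (\<forall>i\<in>{0<..<3}. f (?s i) [^]\<^bsub>A\<^esub> p = \<one>\<^bsub>A\<^esub>) \<and>
        (\<forall>j\<in>{1..5}. f j \<in> generate A (f ` ?s ` {..<3}))"
      if A: "comm_group A" and f: "ab_rels A p C P f" for A :: "('g \<times> 'g) word set monoid" and f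
    proof (intro conjI ballI)
      interpret A: comm_group A by fact
      note rel = ab[OF A f]
      have fc: "f j \<in> carrier A" if "j \<in> {1..5}" for j
        using f that by (auto simp: ab_rels_def)
      show "f (?s 0) [^]\<^bsub>A\<^esub> (p ^ 2) = \<one>\<^bsub>A\<^esub>"
        using rel fc[OF mem(1)] A.nat_pow_pow[of "f x" p p] by (simp add: power2_eq_square)
      show "f (?s i) [^]\<^bsub>A\<^esub> p = \<one>\<^bsub>A\<^esub>" if "i \<in> {0<..<3}" for i
        using that rel unfolding I by auto
      let ?E = "generate A (f ` ?s ` {..<3})"
      have E: "subgroup ?E A" using fc mem unfolding s by (intro A.generate_is_subgroup) auto
      have in_E: "f x \<in> ?E" "f y \<in> ?E" "f z \<in> ?E" unfolding s by (auto intro: generate.incl)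
      have "f x' \<in> ?E"
        using rel A.subgroup_int_pow_closed[OF E in_E(1), of "int p"] by (simp add: int_pow_int)
      moreover have "f t \<in> ?E" using rel generate.one by metis
      moreover fix j :: nat assume "j \<in> {1..5}"
      ultimately show "f j \<in> ?E" using in_E unfolding gens[symmetric] by blast
    qed
    show "(if ?s i = x then 1 else if ?s i = x' then int p else 0) = 0" if "i \<in> {0<..<3}" for i
      using that dist unfolding I by auto
    show "ab_rels (integer_mod_group p) p C P (\<lambda>j. if j = ?s i then 1 else 0)" if "i \<in> {0<..<3}" for i
      using that v unfolding I by auto
    show "(\<Sum>j<3. Suc j) = Suc 5" by (simp add: numeral_eq_Suc)
  qed (use CP v in auto)
qed

text \<open>The chain \<open>x\<close>, \<open>x'\<close>, \<open>x''\<close> of successive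
  \<open>p\<close>-th powers makes up the factor of order \<open>p ^ 3\<close>; its coordinate
  therefore takes the values 1, \<open>p\<close> and the square of \<open>p\<close> along the chain.
  The generator \<open>y\<close> spans the factor of order \<open>p\<close>, and \<open>t\<close>
  dies.\<close>

theorem nabla_pc_group_p3:
  fixes G :: "('g, 'm) monoid_scheme" and p x x' x'' y t :: nat
  assumes G: "group G" "odd (order G)" "G \<cong> pc_group p C P" and p: "1 < p" "odd p"
    and CP: "snd ` set C \<subseteq> words {1..5} \<and> snd ` set P \<subseteq> words {1..5}"
    and gens: "{x, x', x'', y, t} = {1..5}"
    and ab: "\<And>(A :: ('g \<times> 'g) word set monoid) f. comm_group A \<Longrightarrow> ab_rels A p C P f \<Longrightarrow>
      f t = \<one>\<^bsub>A\<^esub> \<and> f x [^]\<^bsub>A\<^esub> p = f x' \<and> f x' [^]\<^bsub>A\<^esub> p = f x'' \<and> f x'' [^]\<^bsub>A\<^esub> p = \<one>\<^bsub>A\<^esub> \<and>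
      f y [^]\<^bsub>A\<^esub> p = \<one>\<^bsub>A\<^esub>"
    and v: "ab_rels (integer_mod_group (p ^ 3)) p C P
        (\<lambda>j. if j = x then 1 else if j = x' then int p else if j = x'' then (int p)\<^sup>2 else 0)"
      "ab_rels (integer_mod_group p) p C P (\<lambda>j. if j = y then 1 else 0)"
  shows "nabla G \<cong> integer_mod_group (p ^ 3) \<times>\<times> cyc_sum p 2"
proof -
  have "card {x, x', x'', y, t} = 5" by (simp only: gens card_atLeastAtMost)
  then have "card (set [x, x', x'', y, t]) = length [x, x', x'', y, t]" by simp
  then have dist: "distinct [x, x', x'', y, t]" by (rule card_distinct)
  have mem: "x \<in> {1..5}" "x' \<in> {1..5}" "y \<in> {1..5}" using gens by blast+
  let ?s = "\<lambda>i. [x, y] ! i"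
  have s: "?s ` {..<2} = {x, y}" by (force simp: numeral_2_eq_2 lessThan_Suc)
  have I: "{0<..<2} = {1::nat}" by auto
  show ?thesis
  proof (rule nabla_pc_group_mixed[OF G p, where s = ?s and d = 2 and e = 3
        and v = "\<lambda>j. if j = x then 1 else if j = x' then int p else if j = x'' then (int p)\<^sup>2 else 0"])
    show "?s ` {..<2} \<subseteq> {1..5}" using mem unfolding s by blast
    show "inj_on ?s {..<2}" using dist by (auto simp: inj_on_def numeral_2_eq_2 less_Suc_eq)
    show "f (?s 0) [^]\<^bsub>A\<^esub> (p ^ 3) = \<one>\<^bsub>A\<^esub> \<and> (\<forall>i\<in>{0<..<2}. f (?s i) [^]\<^bsub>A\<^esub> p = \<one>\<^bsub>A\<^esub>) \<and>
        (\<forall>j\<in>{1..5}. f j \<in> generate A (f ` ?s ` {..<2}))"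
      if A: "comm_group A" and f: "ab_rels A p C P f" for A :: "('g \<times> 'g) word set monoid" and f
    proof (intro conjI ballI)
      interpret A: comm_group A by fact
      note rel = ab[OF A f]
      have fc: "f j \<in> carrier A" if "j \<in> {1..5}" for j
        using f that by (auto simp: ab_rels_def)
      show "f (?s 0) [^]\<^bsub>A\<^esub> (p ^ 3) = \<one>\<^bsub>A\<^esub>"
        using rel fc[OF mem(1)] A.nat_pow_pow[of "f x" p p] A.nat_pow_pow[of "f x" "p * p" p]
        by (simp add: power3_eq_cube)
      show "f (?s i) [^]\<^bsub>A\<^esub> p = \<one>\<^bsub>A\<^esub>" if "i \<in> {0<..<2}" for i
        using that rel unfolding I by auto
      let ?E = "generate A (f ` ?s ` {..<2})"
      have E: "subgroup ?E A" using fc mem unfolding s by (intro A.generate_is_subgroup) auto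
      have in_E: "f x \<in> ?E" "f y \<in> ?E" unfolding s by (auto intro: generate.incl)
      have x': "f x' \<in> ?E"
        using rel A.subgroup_int_pow_closed[OF E in_E(1), of "int p"] by (simp add: int_pow_int)
      then have "f x'' \<in> ?E"
        using rel A.subgroup_int_pow_closed[OF E x', of "int p"] by (simp add: int_pow_int)
      moreover have "f t \<in> ?E" using rel generate.one by metis
      moreover fix j :: nat assume "j \<in> {1..5}"
      ultimately show "f j \<in> ?E" using in_E x' unfolding gens[symmetric] by blast
    qed
    show "(if ?s i = x then 1 else if ?s i = x' then int p else if ?s i = x'' then (int p)\<^sup>2 else 0) = 0"
      if "i \<in> {0<..<2}" for i
      using that dist unfolding I by auto
    show "ab_rels (integer_mod_group p) p C P (\<lambda>j. if j = ?s i then 1 else 0)" if "i \<in> {0<..<2}" for i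
      using that v unfolding I by auto
    show "(\<Sum>j<2. Suc j) = Suc 2" by (simp add: numeral_eq_Suc)
  qed (use CP v in auto)
qed

text \<open>Both cyclic factors have order \<open>p ^ 2\<close>, so \<open>nabla_pc_group\<close> is
  applied directly with a constant modulus, and each coordinate takes the value \<open>p\<close> at
  the \<open>p\<close>-th power of its generator.\<close>

theorem nabla_pc_group_p2_p2:
  fixes G :: "('g, 'm) monoid_scheme" and p x x' y y' t :: nat
  assumes G: "group G" "odd (order G)" "G \<cong> pc_group p C P" and p: "1 < p" "odd p"
    and CP: "snd ` set C \<subseteq> words {1..5} \<and> snd ` set P \<subseteq> words {1..5}"
    and gens: "{x, x', y, y', t} = {1..5}"
    and ab: "\<And>(A :: ('g \<times> 'g) word set monoid) f. comm_group A \<Longrightarrow> ab_rels A p C P f \<Longrightarrow>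
      f t = \<one>\<^bsub>A\<^esub> \<and> f x [^]\<^bsub>A\<^esub> p = f x' \<and> f x' [^]\<^bsub>A\<^esub> p = \<one>\<^bsub>A\<^esub> \<and>
      f y [^]\<^bsub>A\<^esub> p = f y' \<and> f y' [^]\<^bsub>A\<^esub> p = \<one>\<^bsub>A\<^esub>"
    and v: "ab_rels (integer_mod_group (p ^ 2)) p C P
        (\<lambda>j. if j = x then 1 else if j = x' then int p else 0)"
      "ab_rels (integer_mod_group (p ^ 2)) p C P
        (\<lambda>j. if j = y then 1 else if j = y' then int p else 0)"
  shows "nabla G \<cong> cyc_sum (p ^ 2) 3"
proof -
  have "card {x, x', y, y', t} = 5" by (simp only: gens card_atLeastAtMost)
  then have "card (set [x, x', y, y', t]) = length [x, x', y, y', t]" by simp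
  then have dist: "distinct [x, x', y, y', t]" by (rule card_distinct)
  have mem: "x \<in> {1..5}" "y \<in> {1..5}" using gens by blast+
  let ?s = "\<lambda>i. [x, y] ! i" and ?s' = "\<lambda>i. [x', y'] ! i"
  have s: "?s ` {..<2} = {x, y}" by (force simp: numeral_2_eq_2 lessThan_Suc)
  have less_2: "i < 2 \<longleftrightarrow> i = 0 \<or> i = Suc 0" for i :: nat by auto
  have "nabla G \<cong> sum_group {(i, j). i \<le> j \<and> j < (2::nat)}
      (\<lambda>ij. integer_mod_group (gcd (p ^ 2) (p ^ 2)))"
  proof (rule nabla_pc_group[OF G, where s = ?s and n = "\<lambda>_. p ^ 2"
        and v = "\<lambda>i j. if j = ?s i then 1 else if j = ?s' i then int p else 0"])
    show "?s ` {..<2} \<subseteq> {1..5}" using mem unfolding s by blast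
    show "(\<forall>i<2. f (?s i) [^]\<^bsub>A\<^esub> (p ^ 2) = \<one>\<^bsub>A\<^esub>) \<and>
        (\<forall>j\<in>{1..5}. f j \<in> generate A (f ` ?s ` {..<2}))"
      if A: "comm_group A" and f: "ab_rels A p C P f" for A :: "('g \<times> 'g) word set monoid" and f
    proof (intro conjI ballI allI impI)
      interpret A: comm_group A by fact
      note rel = ab[OF A f]
      have fc: "f j \<in> carrier A" if "j \<in> {1..5}" for j
        using f that by (auto simp: ab_rels_def)
      show "f (?s i) [^]\<^bsub>A\<^esub> (p ^ 2) = \<one>\<^bsub>A\<^esub>" if "i < 2" for i
        using that rel fc[OF mem(1)] fc[OF mem(2)] A.nat_pow_pow[of "f x" p p] A.nat_pow_pow[of "f y" p p]
        by (auto simp: power2_eq_square less_2)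
      let ?E = "generate A (f ` ?s ` {..<2})"
      have E: "subgroup ?E A" using fc mem unfolding s by (intro A.generate_is_subgroup) auto
      have in_E: "f x \<in> ?E" "f y \<in> ?E" unfolding s by (auto intro: generate.incl)
      have "f x' \<in> ?E" "f y' \<in> ?E"
        using rel A.subgroup_int_pow_closed[OF E in_E(1), of "int p"]
          A.subgroup_int_pow_closed[OF E in_E(2), of "int p"] by (simp_all add: int_pow_int)
      moreover have "f t \<in> ?E" using rel generate.one by metis
      moreover fix j :: nat assume "j \<in> {1..5}"
      ultimately show "f j \<in> ?E" using in_E unfolding gens[symmetric] by blast
    qed
    show "ab_rels (integer_mod_group (p ^ 2)) p C P
        (\<lambda>j. if j = ?s i then 1 else if j = ?s' i then int p else 0)" if "i < 2" for i
      using that v unfolding less_2 by (elim disjE) (simp_all only: nth_Cons_0 nth_Cons_Suc)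
  qed (use CP p dist in \<open>auto simp: less_2\<close>)
  also have "\<dots> \<cong> cyc_sum (p ^ 2) (\<Sum>j<2. Suc j)"
    by (rule sum_group_iso_cyc_sum) (simp_all add: finite_ordered_pairs card_ordered_pairs)
  finally show ?thesis by (simp add: numeral_eq_Suc)
qed


text \<open>These are the relations demanded by the three preceding theorems, grouped by which
  generators play which role. A \<open>p\<close>-th power that equals a commutator becomes trivial:
  for example \<open>g_2\<close> in row 25, \<open>g_3\<close> in rows 40, 45 and 47, and
  \<open>g_4\<close> in rows 27, 52 and 53.\<close>

lemma rows_powers:
  assumes "comm_group A" and row: "(i, C, P) \<in> set (G_table p w a b k)" and f: "ab_rels A p C P f"
  shows "i \<in> {2} \<Longrightarrow> f 3 = \<one>\<^bsub>A\<^esub> \<and> f 1 [^]\<^bsub>A\<^esub> p = f 4 \<and> f 4 [^]\<^bsub>A\<^esub> p = \<one>\<^bsub>A\<^esub> \<and> f 2 [^]\<^bsub>A\<^esub> p = f 5 \<and> f 5 [^]\<^bsub>A\<^esub> p = \<one>\<^bsub>A\<^esub>"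
    and "i \<in> {14} \<Longrightarrow> f 5 = \<one>\<^bsub>A\<^esub> \<and> f 1 [^]\<^bsub>A\<^esub> p = f 3 \<and> f 3 [^]\<^bsub>A\<^esub> p = \<one>\<^bsub>A\<^esub> \<and> f 2 [^]\<^bsub>A\<^esub> p = f 4 \<and> f 4 [^]\<^bsub>A\<^esub> p = \<one>\<^bsub>A\<^esub>"
    and "i \<in> {35, 37} \<Longrightarrow> f 4 = \<one>\<^bsub>A\<^esub> \<and> f 3 [^]\<^bsub>A\<^esub> p = f 5 \<and> f 5 [^]\<^bsub>A\<^esub> p = \<one>\<^bsub>A\<^esub> \<and> f 1 [^]\<^bsub>A\<^esub> p = \<one>\<^bsub>A\<^esub> \<and> f 2 [^]\<^bsub>A\<^esub> p = \<one>\<^bsub>A\<^esub>"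
    and "i \<in> {40, 45, 47} \<Longrightarrow> f 5 = \<one>\<^bsub>A\<^esub> \<and> f 2 [^]\<^bsub>A\<^esub> p = f 4 \<and> f 4 [^]\<^bsub>A\<^esub> p = \<one>\<^bsub>A\<^esub> \<and> f 1 [^]\<^bsub>A\<^esub> p = \<one>\<^bsub>A\<^esub> \<and> f 3 [^]\<^bsub>A\<^esub> p = \<one>\<^bsub>A\<^esub>"
    and "i \<in> {52, 53} \<Longrightarrow> f 5 = \<one>\<^bsub>A\<^esub> \<and> f 1 [^]\<^bsub>A\<^esub> p = f 4 \<and> f 4 [^]\<^bsub>A\<^esub> p = \<one>\<^bsub>A\<^esub> \<and> f 2 [^]\<^bsub>A\<^esub> p = \<one>\<^bsub>A\<^esub> \<and> f 3 [^]\<^bsub>A\<^esub> p = \<one>\<^bsub>A\<^esub>"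
    and "i \<in> {15, 25} \<Longrightarrow> f 3 = \<one>\<^bsub>A\<^esub> \<and> f 1 [^]\<^bsub>A\<^esub> p = f 4 \<and> f 4 [^]\<^bsub>A\<^esub> p = f 5 \<and> f 5 [^]\<^bsub>A\<^esub> p = \<one>\<^bsub>A\<^esub> \<and> f 2 [^]\<^bsub>A\<^esub> p = \<one>\<^bsub>A\<^esub>"
    and "i \<in> {27} \<Longrightarrow> f 5 = \<one>\<^bsub>A\<^esub> \<and> f 1 [^]\<^bsub>A\<^esub> p = f 3 \<and> f 3 [^]\<^bsub>A\<^esub> p = f 4 \<and> f 4 [^]\<^bsub>A\<^esub> p = \<one>\<^bsub>A\<^esub> \<and> f 2 [^]\<^bsub>A\<^esub> p = \<one>\<^bsub>A\<^esub>"
proof -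
  interpret A: comm_group A by fact
  have c: "f (Suc 0) \<in> carrier A" "f 2 \<in> carrier A" "f 3 \<in> carrier A" "f 4 \<in> carrier A" "f 5 \<in> carrier A"
    using f by (simp_all add: ab_rels_iff)
  note cases = row[unfolded G_table_def list.set insert_iff empty_iff prod.inject]
  note num_cases = numeral_eq_iff num.distinct num.inject simp_thms
  show "f 3 = \<one>\<^bsub>A\<^esub> \<and> f 1 [^]\<^bsub>A\<^esub> p = f 4 \<and> f 4 [^]\<^bsub>A\<^esub> p = \<one>\<^bsub>A\<^esub> \<and> f 2 [^]\<^bsub>A\<^esub> p = f 5 \<and> f 5 [^]\<^bsub>A\<^esub> p = \<one>\<^bsub>A\<^esub>" if "i \<in> {2}"
    using cases that f
    by (elim disjE conjE FalseE; hypsubst)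
      (simp_all only: insert_iff empty_iff num_cases, (simp add: ab_rels_iff rhs_of_def c A.weval_gpow)+)
  show "f 5 = \<one>\<^bsub>A\<^esub> \<and> f 1 [^]\<^bsub>A\<^esub> p = f 3 \<and> f 3 [^]\<^bsub>A\<^esub> p = \<one>\<^bsub>A\<^esub> \<and> f 2 [^]\<^bsub>A\<^esub> p = f 4 \<and> f 4 [^]\<^bsub>A\<^esub> p = \<one>\<^bsub>A\<^esub>" if "i \<in> {14}"
    using cases that f
    by (elim disjE conjE FalseE; hypsubst)
      (simp_all only: insert_iff empty_iff num_cases, (simp add: ab_rels_iff rhs_of_def c A.weval_gpow)+)
  show "f 4 = \<one>\<^bsub>A\<^esub> \<and> f 3 [^]\<^bsub>A\<^esub> p = f 5 \<and> f 5 [^]\<^bsub>A\<^esub> p = \<one>\<^bsub>A\<^esub> \<and> f 1 [^]\<^bsub>A\<^esub> p = \<one>\<^bsub>A\<^esub> \<and> f 2 [^]\<^bsub>A\<^esub> p = \<one>\<^bsub>A\<^esub>" if "i \<in> {35, 37}"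
    using cases that f
    by (elim disjE conjE FalseE; hypsubst)
      (simp_all only: insert_iff empty_iff num_cases, (simp add: ab_rels_iff rhs_of_def c A.weval_gpow)+)
  show "f 5 = \<one>\<^bsub>A\<^esub> \<and> f 2 [^]\<^bsub>A\<^esub> p = f 4 \<and> f 4 [^]\<^bsub>A\<^esub> p = \<one>\<^bsub>A\<^esub> \<and> f 1 [^]\<^bsub>A\<^esub> p = \<one>\<^bsub>A\<^esub> \<and> f 3 [^]\<^bsub>A\<^esub> p = \<one>\<^bsub>A\<^esub>" if "i \<in> {40, 45, 47}"
    using cases that f
    by (elim disjE conjE FalseE; hypsubst)
      (simp_all only: insert_iff empty_iff num_cases, (simp add: ab_rels_iff rhs_of_def c A.weval_gpow)+)
  show "f 5 = \<one>\<^bsub>A\<^esub> \<and> f 1 [^]\<^bsub>A\<^esub> p = f 4 \<and> f 4 [^]\<^bsub>A\<^esub> p = \<one>\<^bsub>A\<^esub> \<and> f 2 [^]\<^bsub>A\<^esub> p = \<one>\<^bsub>A\<^esub> \<and> f 3 [^]\<^bsub>A\<^esub> p = \<one>\<^bsub>A\<^esub>" if "i \<in> {52, 53}"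
    using cases that f
    by (elim disjE conjE FalseE; hypsubst)
      (simp_all only: insert_iff empty_iff num_cases, (simp add: ab_rels_iff rhs_of_def c A.weval_gpow)+)
  show "f 3 = \<one>\<^bsub>A\<^esub> \<and> f 1 [^]\<^bsub>A\<^esub> p = f 4 \<and> f 4 [^]\<^bsub>A\<^esub> p = f 5 \<and> f 5 [^]\<^bsub>A\<^esub> p = \<one>\<^bsub>A\<^esub> \<and> f 2 [^]\<^bsub>A\<^esub> p = \<one>\<^bsub>A\<^esub>" if "i \<in> {15, 25}"
    using cases that f
    by (elim disjE conjE FalseE; hypsubst)
      (simp_all only: insert_iff empty_iff num_cases, (simp add: ab_rels_iff rhs_of_def c A.weval_gpow)+)
  show "f 5 = \<one>\<^bsub>A\<^esub> \<and> f 1 [^]\<^bsub>A\<^esub> p = f 3 \<and> f 3 [^]\<^bsub>A\<^esub> p = f 4 \<and> f 4 [^]\<^bsub>A\<^esub> p = \<one>\<^bsub>A\<^esub> \<and> f 2 [^]\<^bsub>A\<^esub> p = \<one>\<^bsub>A\<^esub>" if "i \<in> {27}"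
    using cases that f
    by (elim disjE conjE FalseE; hypsubst)
      (simp_all only: insert_iff empty_iff num_cases, (simp add: ab_rels_iff rhs_of_def c A.weval_gpow)+)
qed

lemma weval_integer_mod_group_gpow:
  assumes "f i \<in> carrier (integer_mod_group m)"
  shows "weval (integer_mod_group m) f (gpow i n) = (n * f i) mod int m"
  using group.weval_gpow[where y = f and i = i, OF group_integer_mod_group assms] by (simp add: int_pow_integer_mod_group)

text \<open>That these coordinates respect the relations shows that the orders found in
  \<open>rows_powers\<close> are attained, not merely upper bounds.\<close>

lemma rows_dual:
  assumes row: "(i, C, P) \<in> set (G_table p w a b k)" and p: "1 < p"
  shows "i \<in> {2} \<Longrightarrow> ab_rels (integer_mod_group (p ^ 2)) p C P (\<lambda>j. if j = 1 then 1 else if j = 4 then int p else 0) \<and>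
      ab_rels (integer_mod_group (p ^ 2)) p C P (\<lambda>j. if j = 2 then 1 else if j = 5 then int p else 0)"
    and "i \<in> {14} \<Longrightarrow> ab_rels (integer_mod_group (p ^ 2)) p C P (\<lambda>j. if j = 1 then 1 else if j = 3 then int p else 0) \<and>
      ab_rels (integer_mod_group (p ^ 2)) p C P (\<lambda>j. if j = 2 then 1 else if j = 4 then int p else 0)"
    and "i \<in> {35, 37} \<Longrightarrow> ab_rels (integer_mod_group (p ^ 2)) p C P (\<lambda>j. if j = 3 then 1 else if j = 5 then int p else 0) \<and>
      ab_rels (integer_mod_group p) p C P (\<lambda>j. if j = 1 then 1 else 0) \<and>
      ab_rels (integer_mod_group p) p C P (\<lambda>j. if j = 2 then 1 else 0)"
    and "i \<in> {40, 45, 47} \<Longrightarrow> ab_rels (integer_mod_group (p ^ 2)) p C P (\<lambda>j. if j = 2 then 1 else if j = 4 then int p else 0) \<and>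
      ab_rels (integer_mod_group p) p C P (\<lambda>j. if j = 1 then 1 else 0) \<and>
      ab_rels (integer_mod_group p) p C P (\<lambda>j. if j = 3 then 1 else 0)"
    and "i \<in> {52, 53} \<Longrightarrow> ab_rels (integer_mod_group (p ^ 2)) p C P (\<lambda>j. if j = 1 then 1 else if j = 4 then int p else 0) \<and>
      ab_rels (integer_mod_group p) p C P (\<lambda>j. if j = 2 then 1 else 0) \<and>
      ab_rels (integer_mod_group p) p C P (\<lambda>j. if j = 3 then 1 else 0)"
    and "i \<in> {15, 25} \<Longrightarrow> ab_rels (integer_mod_group (p ^ 3)) p C P (\<lambda>j. if j = 1 then 1 else if j = 4 then int p else if j = 5 then (int p)\<^sup>2 else 0) \<and>
      ab_rels (integer_mod_group p) p C P (\<lambda>j. if j = 2 then 1 else 0)"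
    and "i \<in> {27} \<Longrightarrow> ab_rels (integer_mod_group (p ^ 3)) p C P (\<lambda>j. if j = 1 then 1 else if j = 3 then int p else if j = 4 then (int p)\<^sup>2 else 0) \<and>
      ab_rels (integer_mod_group p) p C P (\<lambda>j. if j = 2 then 1 else 0)"
proof -
  \<comment> \<open>Elements of \<open>integer_mod_group\<close> are reduced residues, so the values
    \<open>p\<close> and its square must be shown to be smaller than the modulus.\<close>
  have less: "int p < (int p)\<^sup>2" "(int p)\<^sup>2 < int p ^ 3" "int p < int p ^ 3"
    "1 < (int p)\<^sup>2" "1 < int p ^ 3"
    using p power_strict_increasing[of 1 2 "int p"] power_strict_increasing[of 2 3 "int p"]
      power_strict_increasing[of 1 3 "int p"] power_strict_increasing[of 0 2 "int p"]
      power_strict_increasing[of 0 3 "int p"] by simp_all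
  have zero: "int p * int p mod (int p)\<^sup>2 = 0" "int p * int p mod int p ^ 3 = (int p)\<^sup>2"
    "int p * (int p)\<^sup>2 mod int p ^ 3 = 0" "int p mod (int p)\<^sup>2 = int p"
    "int p mod int p ^ 3 = int p" "(int p)\<^sup>2 mod int p ^ 3 = (int p)\<^sup>2"
    using less p by (simp_all add: power2_eq_square power3_eq_cube)
  have less_nat: "p < p\<^sup>2" "p\<^sup>2 < p ^ 3" "p < p ^ 3" "Suc 0 < p\<^sup>2" "Suc 0 < p ^ 3"
    using less by (simp_all flip: of_nat_power)
  note cases = row[unfolded G_table_def list.set insert_iff empty_iff prod.inject]
  note num_cases = numeral_eq_iff num.distinct num.inject simp_thms
  note eval = ab_rels_iff rhs_of_def weval_integer_mod_group_gpow carrier_integer_mod_group less less_nat zero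
  show "ab_rels (integer_mod_group (p ^ 2)) p C P (\<lambda>j. if j = 1 then 1 else if j = 4 then int p else 0) \<and>
      ab_rels (integer_mod_group (p ^ 2)) p C P (\<lambda>j. if j = 2 then 1 else if j = 5 then int p else 0)"
    if "i \<in> {2}"
    using cases that p
    by (elim disjE conjE FalseE; hypsubst)
      (simp_all only: insert_iff empty_iff num_cases, (simp add: eval)+)
  show "ab_rels (integer_mod_group (p ^ 2)) p C P (\<lambda>j. if j = 1 then 1 else if j = 3 then int p else 0) \<and>
      ab_rels (integer_mod_group (p ^ 2)) p C P (\<lambda>j. if j = 2 then 1 else if j = 4 then int p else 0)"
    if "i \<in> {14}"
    using cases that p
    by (elim disjE conjE FalseE; hypsubst)
      (simp_all only: insert_iff empty_iff num_cases, (simp add: eval)+)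
  show "ab_rels (integer_mod_group (p ^ 2)) p C P (\<lambda>j. if j = 3 then 1 else if j = 5 then int p else 0) \<and>
      ab_rels (integer_mod_group p) p C P (\<lambda>j. if j = 1 then 1 else 0) \<and>
      ab_rels (integer_mod_group p) p C P (\<lambda>j. if j = 2 then 1 else 0)"
    if "i \<in> {35, 37}"
    using cases that p
    by (elim disjE conjE FalseE; hypsubst)
      (simp_all only: insert_iff empty_iff num_cases, (simp add: eval)+)
  show "ab_rels (integer_mod_group (p ^ 2)) p C P (\<lambda>j. if j = 2 then 1 else if j = 4 then int p else 0) \<and>
      ab_rels (integer_mod_group p) p C P (\<lambda>j. if j = 1 then 1 else 0) \<and>
      ab_rels (integer_mod_group p) p C P (\<lambda>j. if j = 3 then 1 else 0)"
    if "i \<in> {40, 45, 47}"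
    using cases that p
    by (elim disjE conjE FalseE; hypsubst)
      (simp_all only: insert_iff empty_iff num_cases, (simp add: eval)+)
  show "ab_rels (integer_mod_group (p ^ 2)) p C P (\<lambda>j. if j = 1 then 1 else if j = 4 then int p else 0) \<and>
      ab_rels (integer_mod_group p) p C P (\<lambda>j. if j = 2 then 1 else 0) \<and>
      ab_rels (integer_mod_group p) p C P (\<lambda>j. if j = 3 then 1 else 0)"
    if "i \<in> {52, 53}"
    using cases that p
    by (elim disjE conjE FalseE; hypsubst)
      (simp_all only: insert_iff empty_iff num_cases, (simp add: eval)+)
  show "ab_rels (integer_mod_group (p ^ 3)) p C P (\<lambda>j. if j = 1 then 1 else if j = 4 then int p else if j = 5 then (int p)\<^sup>2 else 0) \<and>
      ab_rels (integer_mod_group p) p C P (\<lambda>j. if j = 2 then 1 else 0)"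
    if "i \<in> {15, 25}"
    using cases that p
    by (elim disjE conjE FalseE; hypsubst)
      (simp_all only: insert_iff empty_iff num_cases, (simp add: eval)+)
  show "ab_rels (integer_mod_group (p ^ 3)) p C P (\<lambda>j. if j = 1 then 1 else if j = 3 then int p else if j = 4 then (int p)\<^sup>2 else 0) \<and>
      ab_rels (integer_mod_group p) p C P (\<lambda>j. if j = 2 then 1 else 0)"
    if "i \<in> {27}"
    using cases that p
    by (elim disjE conjE FalseE; hypsubst)
      (simp_all only: insert_iff empty_iff num_cases, (simp add: eval)+)
qed


text \<open>Each case fixes the roles of the five generators, as in \<open>rows_powers\<close>, and
  combines these relations with the matching coordinates of \<open>rows_dual\<close>.\<close>

lemma nabla_G_mixed:
  fixes G :: "('g, 'm) monoid_scheme" and p k :: nat and w a b :: int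
  assumes p: "1 < p" "odd p" and G: "group G" "odd (order G)" and iso: "G \<cong> G_grp p w a b k i"
  shows "i \<in> {2} \<Longrightarrow> nabla G \<cong> cyc_sum (p ^ 2) 3"
    and "i \<in> {14} \<Longrightarrow> nabla G \<cong> cyc_sum (p ^ 2) 3"
    and "i \<in> {35, 37} \<Longrightarrow> nabla G \<cong> integer_mod_group (p ^ 2) \<times>\<times> cyc_sum p 5"
    and "i \<in> {40, 45, 47} \<Longrightarrow> nabla G \<cong> integer_mod_group (p ^ 2) \<times>\<times> cyc_sum p 5"
    and "i \<in> {52, 53} \<Longrightarrow> nabla G \<cong> integer_mod_group (p ^ 2) \<times>\<times> cyc_sum p 5"
    and "i \<in> {15, 25} \<Longrightarrow> nabla G \<cong> integer_mod_group (p ^ 3) \<times>\<times> cyc_sum p 2"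
    and "i \<in> {27} \<Longrightarrow> nabla G \<cong> integer_mod_group (p ^ 3) \<times>\<times> cyc_sum p 2"
proof -
  show "nabla G \<cong> cyc_sum (p ^ 2) 3" if i: "i \<in> {2}"
  proof -
    have "i \<in> fst ` set (G_table p w a b k)" using i by (auto simp: G_table_def)
    then obtain C P where row: "(i, C, P) \<in> set (G_table p w a b k)"
      and eq: "G_grp p w a b k i = pc_group p C P" by (rule G_grp_row)
    note dual = rows_dual(1)[OF row p(1) i]
    show ?thesis
    proof (rule nabla_pc_group_p2_p2[where x = 1 and x' = 4 and y = 2 and y' = 5 and t = 3, OF G iso[unfolded eq] p G_table_words(1)[OF row]])
      fix A :: "('g \<times> 'g) word set monoid" and f
      assume "comm_group A" "ab_rels A p C P f"
      from rows_powers(1)[OF this(1) row this(2) i]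
      show "f 3 = \<one>\<^bsub>A\<^esub> \<and> f 1 [^]\<^bsub>A\<^esub> p = f 4 \<and> f 4 [^]\<^bsub>A\<^esub> p = \<one>\<^bsub>A\<^esub> \<and> f 2 [^]\<^bsub>A\<^esub> p = f 5 \<and> f 5 [^]\<^bsub>A\<^esub> p = \<one>\<^bsub>A\<^esub>" by simp
    qed (use dual in auto)
  qed
  show "nabla G \<cong> cyc_sum (p ^ 2) 3" if i: "i \<in> {14}"
  proof -
    have "i \<in> fst ` set (G_table p w a b k)" using i by (auto simp: G_table_def)
    then obtain C P where row: "(i, C, P) \<in> set (G_table p w a b k)"
      and eq: "G_grp p w a b k i = pc_group p C P" by (rule G_grp_row)
    note dual = rows_dual(2)[OF row p(1) i]
    show ?thesis
    proof (rule nabla_pc_group_p2_p2[where x = 1 and x' = 3 and y = 2 and y' = 4 and t = 5, OF G iso[unfolded eq] p G_table_words(1)[OF row]])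
      fix A :: "('g \<times> 'g) word set monoid" and f
      assume "comm_group A" "ab_rels A p C P f"
      from rows_powers(2)[OF this(1) row this(2) i]
      show "f 5 = \<one>\<^bsub>A\<^esub> \<and> f 1 [^]\<^bsub>A\<^esub> p = f 3 \<and> f 3 [^]\<^bsub>A\<^esub> p = \<one>\<^bsub>A\<^esub> \<and> f 2 [^]\<^bsub>A\<^esub> p = f 4 \<and> f 4 [^]\<^bsub>A\<^esub> p = \<one>\<^bsub>A\<^esub>" by simp
    qed (use dual in auto)
  qed
  show "nabla G \<cong> integer_mod_group (p ^ 2) \<times>\<times> cyc_sum p 5" if i: "i \<in> {35, 37}"
  proof -
    have "i \<in> fst ` set (G_table p w a b k)" using i by (auto simp: G_table_def)
    then obtain C P where row: "(i, C, P) \<in> set (G_table p w a b k)"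
      and eq: "G_grp p w a b k i = pc_group p C P" by (rule G_grp_row)
    note dual = rows_dual(3)[OF row p(1) i]
    show ?thesis
    proof (rule nabla_pc_group_p2[where x = 3 and x' = 5 and y = 1 and z = 2 and t = 4, OF G iso[unfolded eq] p G_table_words(1)[OF row]])
      fix A :: "('g \<times> 'g) word set monoid" and f
      assume "comm_group A" "ab_rels A p C P f"
      from rows_powers(3)[OF this(1) row this(2) i]
      show "f 4 = \<one>\<^bsub>A\<^esub> \<and> f 3 [^]\<^bsub>A\<^esub> p = f 5 \<and> f 5 [^]\<^bsub>A\<^esub> p = \<one>\<^bsub>A\<^esub> \<and> f 1 [^]\<^bsub>A\<^esub> p = \<one>\<^bsub>A\<^esub> \<and> f 2 [^]\<^bsub>A\<^esub> p = \<one>\<^bsub>A\<^esub>" by simp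
    qed (use dual in auto)
  qed
  show "nabla G \<cong> integer_mod_group (p ^ 2) \<times>\<times> cyc_sum p 5" if i: "i \<in> {40, 45, 47}"
  proof -
    have "i \<in> fst ` set (G_table p w a b k)" using i by (auto simp: G_table_def)
    then obtain C P where row: "(i, C, P) \<in> set (G_table p w a b k)"
      and eq: "G_grp p w a b k i = pc_group p C P" by (rule G_grp_row)
    note dual = rows_dual(4)[OF row p(1) i]
    show ?thesis
    proof (rule nabla_pc_group_p2[where x = 2 and x' = 4 and y = 1 and z = 3 and t = 5, OF G iso[unfolded eq] p G_table_words(1)[OF row]])
      fix A :: "('g \<times> 'g) word set monoid" and f
      assume "comm_group A" "ab_rels A p C P f"
      from rows_powers(4)[OF this(1) row this(2) i]
      show "f 5 = \<one>\<^bsub>A\<^esub> \<and> f 2 [^]\<^bsub>A\<^esub> p = f 4 \<and> f 4 [^]\<^bsub>A\<^esub> p = \<one>\<^bsub>A\<^esub> \<and> f 1 [^]\<^bsub>A\<^esub> p = \<one>\<^bsub>A\<^esub> \<and> f 3 [^]\<^bsub>A\<^esub> p = \<one>\<^bsub>A\<^esub>" by simp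
    qed (use dual in auto)
  qed
  show "nabla G \<cong> integer_mod_group (p ^ 2) \<times>\<times> cyc_sum p 5" if i: "i \<in> {52, 53}"
  proof -
    have "i \<in> fst ` set (G_table p w a b k)" using i by (auto simp: G_table_def)
    then obtain C P where row: "(i, C, P) \<in> set (G_table p w a b k)"
      and eq: "G_grp p w a b k i = pc_group p C P" by (rule G_grp_row)
    note dual = rows_dual(5)[OF row p(1) i]
    show ?thesis
    proof (rule nabla_pc_group_p2[where x = 1 and x' = 4 and y = 2 and z = 3 and t = 5, OF G iso[unfolded eq] p G_table_words(1)[OF row]])
      fix A :: "('g \<times> 'g) word set monoid" and f
      assume "comm_group A" "ab_rels A p C P f"
      from rows_powers(5)[OF this(1) row this(2) i]
      show "f 5 = \<one>\<^bsub>A\<^esub> \<and> f 1 [^]\<^bsub>A\<^esub> p = f 4 \<and> f 4 [^]\<^bsub>A\<^esub> p = \<one>\<^bsub>A\<^esub> \<and> f 2 [^]\<^bsub>A\<^esub> p = \<one>\<^bsub>A\<^esub> \<and> f 3 [^]\<^bsub>A\<^esub> p = \<one>\<^bsub>A\<^esub>" by simp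
    qed (use dual in auto)
  qed
  show "nabla G \<cong> integer_mod_group (p ^ 3) \<times>\<times> cyc_sum p 2" if i: "i \<in> {15, 25}"
  proof -
    have "i \<in> fst ` set (G_table p w a b k)" using i by (auto simp: G_table_def)
    then obtain C P where row: "(i, C, P) \<in> set (G_table p w a b k)"
      and eq: "G_grp p w a b k i = pc_group p C P" by (rule G_grp_row)
    note dual = rows_dual(6)[OF row p(1) i]
    show ?thesis
    proof (rule nabla_pc_group_p3[where x = 1 and x' = 4 and x'' = 5 and y = 2 and t = 3, OF G iso[unfolded eq] p G_table_words(1)[OF row]])
      fix A :: "('g \<times> 'g) word set monoid" and f
      assume "comm_group A" "ab_rels A p C P f"
      from rows_powers(6)[OF this(1) row this(2) i]
      show "f 3 = \<one>\<^bsub>A\<^esub> \<and> f 1 [^]\<^bsub>A\<^esub> p = f 4 \<and> f 4 [^]\<^bsub>A\<^esub> p = f 5 \<and> f 5 [^]\<^bsub>A\<^esub> p = \<one>\<^bsub>A\<^esub> \<and> f 2 [^]\<^bsub>A\<^esub> p = \<one>\<^bsub>A\<^esub>" by simp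
    qed (use dual in auto)
  qed
  show "nabla G \<cong> integer_mod_group (p ^ 3) \<times>\<times> cyc_sum p 2" if i: "i \<in> {27}"
  proof -
    have "i \<in> fst ` set (G_table p w a b k)" using i by (auto simp: G_table_def)
    then obtain C P where row: "(i, C, P) \<in> set (G_table p w a b k)"
      and eq: "G_grp p w a b k i = pc_group p C P" by (rule G_grp_row)
    note dual = rows_dual(7)[OF row p(1) i]
    show ?thesis
    proof (rule nabla_pc_group_p3[where x = 1 and x' = 3 and x'' = 4 and y = 2 and t = 5, OF G iso[unfolded eq] p G_table_words(1)[OF row]])
      fix A :: "('g \<times> 'g) word set monoid" and f
      assume "comm_group A" "ab_rels A p C P f"
      from rows_powers(7)[OF this(1) row this(2) i]
      show "f 5 = \<one>\<^bsub>A\<^esub> \<and> f 1 [^]\<^bsub>A\<^esub> p = f 3 \<and> f 3 [^]\<^bsub>A\<^esub> p = f 4 \<and> f 4 [^]\<^bsub>A\<^esub> p = \<one>\<^bsub>A\<^esub> \<and> f 2 [^]\<^bsub>A\<^esub> p = \<one>\<^bsub>A\<^esub>" by simp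
    qed (use dual in auto)
  qed
qed

theorem lemma2p4:
  fixes G :: "('g, 'm) monoid_scheme" and p k :: nat and w a b :: int
  assumes "prime p" and "p > 3"
    and "residue_primroot p (nat (w mod int p))"
    and "[a ^ 3 = 1] (mod int p)" and "[b ^ 4 = 1] (mod int p)"
    and "k \<in> {1..(p - 1) div 2}"
    and "group G" and "\<not> comm_group G" and "order G = p ^ 5"
  shows
    "(\<forall>i \<in> {3..10} \<union> {11, 12, 28, 29, 30, 31, 32, 33}.
        G \<cong> G_grp p w a b k i \<longrightarrow> nabla G \<cong> cyc_sum p 3) \<and>
     (\<forall>i \<in> {34, 36, 38, 39, 41, 42, 44, 46, 48, 49, 50} \<union> {54..63}.
        G \<cong> G_grp p w a b k i \<longrightarrow> nabla G \<cong> cyc_sum p 6) \<and>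
     (\<forall>i \<in> {64, 65, 67, 68, 69}.
        G \<cong> G_grp p w a b k i \<longrightarrow> nabla G \<cong> cyc_sum p 10) \<and>
     (\<forall>i \<in> {2, 14}.
        G \<cong> G_grp p w a b k i \<longrightarrow> nabla G \<cong> cyc_sum (p ^ 2) 3) \<and>
     (\<forall>i \<in> {35, 37, 40, 45, 47, 52, 53}.
        G \<cong> G_grp p w a b k i \<longrightarrow>
        nabla G \<cong> integer_mod_group (p ^ 2) \<times>\<times> cyc_sum p 5) \<and>
     (\<forall>i \<in> {15, 25, 27}.
        G \<cong> G_grp p w a b k i \<longrightarrow>
        nabla G \<cong> integer_mod_group (p ^ 3) \<times>\<times> cyc_sum p 2)"
proof -
  have odd: "odd p" "odd (order G)" and p: "1 < p"
    using assms(1,2,9) prime_odd_nat by auto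
  have k: "1 \<le> k" using assms(6) by simp
  note elementary = nabla_G_elementary[OF assms(1-3) k assms(7) odd(2)]
  note mixed = nabla_G_mixed[OF p odd(1) assms(7) odd(2)]
  show ?thesis
  proof (intro conjI ballI impI)
    fix i
    assume iso: "G \<cong> G_grp p w a b k i"
    show "nabla G \<cong> cyc_sum p 3" if "i \<in> {3..10} \<union> {11, 12, 28, 29, 30, 31, 32, 33}"
      using elementary(1)[OF iso that] .
    show "nabla G \<cong> cyc_sum p 6"
      if "i \<in> {34, 36, 38, 39, 41, 42, 44, 46, 48, 49, 50} \<union> {54..63}"
      using elementary(2)[OF iso that] .
    show "nabla G \<cong> cyc_sum p 10" if "i \<in> {64, 65, 67, 68, 69}"
      using elementary(3)[OF iso that] .
    show "nabla G \<cong> cyc_sum (p ^ 2) 3" if "i \<in> {2, 14}"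
      using that mixed(1,2)[OF iso] by blast
    show "nabla G \<cong> integer_mod_group (p ^ 2) \<times>\<times> cyc_sum p 5" if "i \<in> {35, 37, 40, 45, 47, 52, 53}"
      using that mixed(3-5)[OF iso] by blast
    show "nabla G \<cong> integer_mod_group (p ^ 3) \<times>\<times> cyc_sum p 2" if "i \<in> {15, 25, 27}"
      using that mixed(6,7)[OF iso] by blast
  qed
qed

end
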